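(* Fix an initial point $x_0\in\mathbb{R}^n$, a final time $t_f>0$, initial control values $(u_{10},\dots,u_{m0})$ with $u_{i0}\in\{a_i,b_i\}$, and component indices $(i_1,\dots,i_N)\in\{1,\dots,m\}^N$. Then the reduced end-point mapping $(t_1,\dots,t_N)\mapsto E(t_1,\dots,t_N)\in\mathbb{R}^n$ is differentiable at every $(t_1,\dots,t_N)$ of its domain. With $u$ the bang-bang control represented by $\big((u_{10},\dots,u_{m0}),(t_1,i_1),\dots,(t_N,i_N),t_f\big)$ and $x(\cdot)$ the associated trajectory starting at $x(0)=x_0$, its differential is the $n\times N$ real matrix $$dE(t_1,\dots,t_N)=\begin{pmatrix} v_1(t_f) & \cdots & v_N(t_f)\end{pmatrix},$$ whose $j$-th column is $v_j(t_f)$, where for each $j\in\{1,\dots,N\}$, $v_j(\cdot)$ is the solution on $[t_j,t_f]$ of the Cauchy problem $$\dot v_j(t)=\frac{\partial f}{\partial x}(t,x(t),u(t))\,v_j(t),$$ $$v_j(t_j)=\begin{cases} f\big(t_j,x(t_j),(\dots,a_{i_j},\dots)\big)-f\big(t_j,x(t_j),u(t_j^+)\big) & \text{if } u_{i_j}\text{ switches from } a_{i_j}\text{ to } b_{i_j}\text{ at } t_j,\\ f\big(t_j,x(t_j),(\dots,b_{i_j},\dots)\big)-f\big(t_j,x(t_j),u(t_j^+)\big) & \text{if } u_{i_j}\text{ switches from } b_{i_j}\text{ to } a_{i_j}\text{ at } t_j.\end{cases}$$ Here $(\dots,a_{i_j},\dots)$ (resp. $(\dots,b_{i_j},\dots)$)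 denotes the vector that differs from $u(t_j^+)$ only in its $i_j$-th component, which is equal to $a_{i_j}$ (resp. $b_{i_j}$).
   Context: Setting: $f:\mathbb{R}\times\mathbb{R}^n\times\mathbb{R}^m\to\mathbb{R}^n$ is smooth and the control system is $\dot x(t)=f(t,x(t),u(t))$, with controls $u\in L^\infty([0,t_f];\Omega)$, $\Omega=[a_1,b_1]\times\cdots\times[a_m,b_m]$, $a_i<b_i$. Trajectories are absolutely continuous and satisfy the equation almost everywhere. Controls are bang-bang with finitely many switchings: $u_i(t)\in\{a_i,b_i\}$ for almost every $t$ and every $i$, and each $u_i$ switches only finitely many times. At each switching time exactly one component switches. Such a control is represented by the vector $\big((u_{10},\dots,u_{m0}),(t_1,i_1),\dots,(t_N,i_N),t_f\big)$, where $0<t_1<\cdots<t_N<t_f$ are the switching times, $u_{i0}\in\{a_i,b_i\}$ is the value of $u_i$ on $(0,t_1)$, and $i_j$ is the index of the component that switches (from one of the values $a_{i_j},b_{i_j}$ to the other) at time $t_j$. The control is thus piecewise constant; $u(t_j^-)$ and $u(t_j^+)$ denote its left and right limits at $t_j$. Reduced end-point mapping: with $x_0$, $(u_{10},\dots,u_{m0})$, $(i_1,\dots,i_N)$ and $t_f$ fixed, $E(t_1,\dots,t_N)=x_u(t_f)$, where $u$ is the control represented by the vector $\big((u_{10},\dots,u_{m0}),(t_1,i_1),\dots,(t_N,i_N),t_f\big)$ and $x_u(\cdot)$ is the solution of $\dot x=f(t,x,u)$, $x(0)=x_0$. Its domain is the set of $(t_1,\dots,t_N)$ with $0<t_1<\cdots<t_N<t_f$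 for which this solution is defined on all of $[0,t_f]$. *)

theory Defs
  imports "HOL-Analysis.Analysis"
begin

(* Class C^k. The recursion asks that f is Frechet differentiable everywhere and that all its
   directional derivatives are C^k; on a finite-dimensional space this is the usual notion. *)
primrec C_k :: "nat \<Rightarrow> ('a::euclidean_space \<Rightarrow> 'b::euclidean_space) \<Rightarrow> bool" where
  "C_k 0 f \<longleftrightarrow> continuous_on UNIV f"
| "C_k (Suc k) f \<longleftrightarrow>
     (\<forall>x. f differentiable (at x)) \<and> (\<forall>v. C_k k (\<lambda>x. frechet_derivative f (at x) v))"

definition smooth :: "('a::euclidean_space \<Rightarrow> 'b::euclidean_space) \<Rightarrow> bool" where
  "smooth f \<longleftrightarrow> (\<forall>k. C_k k f)"

(* Absolute continuity on a set of reals: d ranges over the finite families of non-overlapping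
   compact intervals contained in S. *)
definition absolutely_continuous_fun_on :: "real set \<Rightarrow> (real \<Rightarrow> 'a::euclidean_space) \<Rightarrow> bool" where
  "absolutely_continuous_fun_on S x \<longleftrightarrow>
     (\<forall>\<epsilon>>0. \<exists>\<delta>>0. \<forall>d. d division_of \<Union>d \<and> \<Union>d \<subseteq> S \<and> (\<Sum>K\<in>d. Sup K - Inf K) < \<delta> \<longrightarrow>
        (\<Sum>K\<in>d. norm (x (Sup K) - x (Inf K))) < \<epsilon>)"

definition ode_solution ::
  "(real \<Rightarrow> 'a::euclidean_space \<Rightarrow> 'a) \<Rightarrow> real \<Rightarrow> real \<Rightarrow> (real \<Rightarrow> 'a) \<Rightarrow> bool" where
  "ode_solution F c d x \<longleftrightarrow>
     absolutely_continuous_fun_on {c..d} x \<and>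
     (AE s in lebesgue. s \<in> {c..d} \<longrightarrow>
        (x has_vector_derivative F s (x s)) (at s within {c..d}))"

(* The index type 'k of the switching times is a finite linear order, 1 < ... < N; thus
   N = CARD('k). *)
definition switching_times :: "real \<Rightarrow> real ^ ('k::{finite,linorder}) \<Rightarrow> bool" where
  "switching_times tf t \<longleftrightarrow> strict_mono (($) t) \<and> (\<forall>j. 0 < t $ j \<and> t $ j < tf)"

definition other_value :: "real \<Rightarrow> real \<Rightarrow> real \<Rightarrow> real" where
  "other_value p q y = (if y = p then q else p)"

(* The control represented by (u0, (t_j, idx j)_j, tf): component i starts at u0 $ i and has been
   switched once for each j with idx j = i and t_j \<le> s. The right-continuous representative is
   chosen; trajectories do not depend on the values at the switching times. *)
definition bang_bang_control ::
  "real ^ 'm \<Rightarrow> real ^ 'm \<Rightarrow> real ^ 'm \<Rightarrow> ('k \<Rightarrow> 'm) \<Rightarrow> real ^ ('k::{finite,linorder})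
     \<Rightarrow> real \<Rightarrow> real ^ ('m::finite)" where
  "bang_bang_control a b u0 idx t s =
     (\<chi> i. (other_value (a $ i) (b $ i) ^^ card {j. idx j = i \<and> t $ j \<le> s}) (u0 $ i))"

definition trajectory ::
  "(real \<Rightarrow> real ^ 'n \<Rightarrow> real ^ 'm \<Rightarrow> real ^ 'n) \<Rightarrow> real ^ ('n::finite) \<Rightarrow> real
     \<Rightarrow> (real \<Rightarrow> real ^ ('m::finite)) \<Rightarrow> (real \<Rightarrow> real ^ 'n) \<Rightarrow> bool" where
  "trajectory f x0 tf u x \<longleftrightarrow> ode_solution (\<lambda>s y. f s y (u s)) 0 tf x \<and> x 0 = x0"

definition endpoint_domain ::
  "(real \<Rightarrow> real ^ 'n \<Rightarrow> real ^ 'm \<Rightarrow> real ^ 'n) \<Rightarrow> real ^ 'm \<Rightarrow> real ^ 'm \<Rightarrow> real ^ ('n::finite)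
     \<Rightarrow> real \<Rightarrow> real ^ 'm \<Rightarrow> ('k \<Rightarrow> 'm::finite) \<Rightarrow> (real ^ ('k::{finite,linorder})) set" where
  "endpoint_domain f a b x0 tf u0 idx =
     {t. switching_times tf t \<and> (\<exists>x. trajectory f x0 tf (bang_bang_control a b u0 idx t) x)}"

(* Only meaningful on endpoint_domain, where the trajectory is unique on {0..tf}. *)
definition endpoint_map ::
  "(real \<Rightarrow> real ^ 'n \<Rightarrow> real ^ 'm \<Rightarrow> real ^ 'n) \<Rightarrow> real ^ 'm \<Rightarrow> real ^ 'm \<Rightarrow> real ^ ('n::finite)
     \<Rightarrow> real \<Rightarrow> real ^ 'm \<Rightarrow> ('k \<Rightarrow> 'm::finite) \<Rightarrow> real ^ ('k::{finite,linorder}) \<Rightarrow> real ^ 'n" where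
  "endpoint_map f a b x0 tf u0 idx t =
     (THE y. \<exists>x. trajectory f x0 tf (bang_bang_control a b u0 idx t) x \<and> y = x tf)"

definition set_component :: "real ^ 'm \<Rightarrow> 'm \<Rightarrow> real \<Rightarrow> real ^ ('m::finite)" where
  "set_component w i c = (\<chi> k. if k = i then c else w $ k)"

definition switches_at ::
  "(real \<Rightarrow> real ^ ('m::finite)) \<Rightarrow> 'm \<Rightarrow> real \<Rightarrow> real \<Rightarrow> real \<Rightarrow> bool" where
  "switches_at u i s p q \<longleftrightarrow> Lim (at_left s) u $ i = p \<and> Lim (at_right s) u $ i = q"

(* The Cauchy problem for v_j along the pair (u, x), where s = t_j and i = i_j. *)
definition variation_solution ::
  "(real \<Rightarrow> real ^ 'n \<Rightarrow> real ^ 'm \<Rightarrow> real ^ 'n) \<Rightarrow> real ^ 'm \<Rightarrow> real ^ 'm \<Rightarrow> real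
     \<Rightarrow> (real \<Rightarrow> real ^ 'm) \<Rightarrow> (real \<Rightarrow> real ^ ('n::finite)) \<Rightarrow> real \<Rightarrow> ('m::finite)
     \<Rightarrow> (real \<Rightarrow> real ^ 'n) \<Rightarrow> bool" where
  "variation_solution f a b tf u x s i v \<longleftrightarrow>
     ode_solution (\<lambda>r w. frechet_derivative (\<lambda>y. f r y (u r)) (at (x r)) w) s tf v \<and>
     (let uR = Lim (at_right s) u in
       (switches_at u i s (a $ i) (b $ i) \<longrightarrow>
          v s = f s (x s) (set_component uR i (a $ i)) - f s (x s) uR) \<and>
       (switches_at u i s (b $ i) (a $ i) \<longrightarrow>
          v s = f s (x s) (set_component uR i (b $ i)) - f s (x s) uR))"

end

theory Submission
  imports Defs
begin

text \<open>The control depends on the switching times only through the set of switchings performed so far,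
  so the difference of the right-hand sides for two vectors \<open>t\<close> and \<open>t'\<close> of switching times
  telescopes into a sum over \<open>j\<close> of terms supported between \<open>t $ j\<close> and \<open>t' $ j\<close>. For the field
  truncated outside a large ball, trajectories exist for all \<open>t'\<close>, and Gronwall's inequality makes them
  O(norm (t' - t)) close to the given one, hence trajectories of \<open>f\<close> itself. Let
  \<open>V s\<close> be the sum of \<open>(t' $ j - t $ j) *\<^sub>R v j s\<close> over those \<open>j\<close> with \<open>t $ j \<le> s\<close>.
  Then \<open>y - x - V = Z + q\<close>, where \<open>Z\<close> is continuous and satisfies a linear integral inequality,
  and \<open>q\<close>, which collects the short intervals between \<open>t $ j\<close> and \<open>t' $ j\<close>, is o(norm (t' - t))
  in the mean and at the final time. Gronwall's inequality for \<open>Z\<close> gives the differential.\<close>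

section \<open>Absolutely continuous functions and Caratheodory solutions\<close>

text \<open>The function \<open>V\<close> jumps at each \<open>t $ j\<close> while
  \<open>y - x\<close> is continuous. For \<open>s\<close> between \<open>t $ j\<close> and
  \<open>t' $ j\<close> the error \<open>y - x - V\<close> is therefore in general of the same order
  as \<open>norm (t' - t)\<close>, and no uniform o(norm (t' - t)) estimate is possible. These
  stretches are short, however: under an integral they contribute only second order, and since
  \<open>t $ j < tf\<close> they are over at the final time. This forces the splitting: the response
  to the change of state goes into the primitive \<open>Z\<close>, to which Gronwall applies, and
  \<open>q\<close> enters that inequality only under the integral. The sign of the initial value has
  this origin: postponing a switching keeps the earlier control value in force for longer, so the
  state gains, per unit of delay, the velocity before the switching minus the velocity after it. All
  estimates are made on integral equations; absolute continuity serves to pass to and from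
  them.\<close>

lemma absolutely_continuous_fun_onE:
  assumes "absolutely_continuous_fun_on S x" "e > 0"
  obtains \<delta> where "\<delta> > 0" "\<And>D. D division_of \<Union>D \<Longrightarrow> \<Union>D \<subseteq> S \<Longrightarrow>
      (\<Sum>K\<in>D. Sup K - Inf K) < \<delta> \<Longrightarrow> (\<Sum>K\<in>D. norm (x (Sup K) - x (Inf K))) < e"
proof -
  obtain \<delta> where "\<delta> > 0" and "\<forall>d. d division_of \<Union>d \<and> \<Union>d \<subseteq> S \<and> (\<Sum>K\<in>d. Sup K - Inf K) < \<delta> \<longrightarrow>
        (\<Sum>K\<in>d. norm (x (Sup K) - x (Inf K))) < e"
    using assms(1)[unfolded absolutely_continuous_fun_on_def, rule_format, OF assms(2)]
    by (elim exE conjE)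
  then show thesis by (intro that[of \<delta>]) blast+
qed

lemma absolutely_continuous_fun_on_subset:
  assumes "absolutely_continuous_fun_on S x" "T \<subseteq> S"
  shows "absolutely_continuous_fun_on T x"
  unfolding absolutely_continuous_fun_on_def
proof (intro allI impI)
  fix e :: real assume "e > 0"
  then obtain \<delta> where "\<delta> > 0" and \<delta>: "\<And>d. d division_of \<Union>d \<Longrightarrow> \<Union>d \<subseteq> S \<Longrightarrow>
      (\<Sum>K\<in>d. Sup K - Inf K) < \<delta> \<Longrightarrow> (\<Sum>K\<in>d. norm (x (Sup K) - x (Inf K))) < e"
    using absolutely_continuous_fun_onE[OF assms(1)] by blast
  then show "\<exists>\<delta>>0. \<forall>d. d division_of \<Union>d \<and> \<Union>d \<subseteq> T \<and> (\<Sum>K\<in>d. Sup K - Inf K) < \<delta> \<longrightarrow>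
        (\<Sum>K\<in>d. norm (x (Sup K) - x (Inf K))) < e"
    using assms(2) by (intro exI[of _ \<delta>]) (auto dest: order_trans)
qed

lemma lipschitz_imp_absolutely_continuous_fun_on:
  assumes "\<And>r s. r \<in> {c..d} \<Longrightarrow> s \<in> {c..d} \<Longrightarrow> norm (x r - x s) \<le> B * \<bar>r - s\<bar>"
  shows "absolutely_continuous_fun_on {c..d} x"
  unfolding absolutely_continuous_fun_on_def
proof (intro allI impI)
  fix e :: real assume e: "e > 0"
  define \<delta> where "\<delta> = e / (\<bar>B\<bar> + 1)"
  have "\<delta> > 0" using e by (simp add: \<delta>_def)
  moreover have "(\<Sum>K\<in>\<D>. norm (x (Sup K) - x (Inf K))) < e"
    if D: "\<D> division_of \<Union>\<D>" "\<Union>\<D> \<subseteq> {c..d}" and s: "(\<Sum>K\<in>\<D>. Sup K - Inf K) < \<delta>" for \<D>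
  proof -
    have *: "norm (x (Sup K) - x (Inf K)) \<le> (\<bar>B\<bar> + 1) * (Sup K - Inf K)" if KD: "K \<in> \<D>" for K
    proof -
      obtain a b where K: "K = {a..b}" "a \<le> b"
        using division_ofD(3,4)[OF D(1) KD] by (metis atLeastatMost_empty_iff2 box_real(2) linorder_linear)
      then have "a \<in> {c..d}" "b \<in> {c..d}"
        using that D(2) by fastforce+
      then have "norm (x b - x a) \<le> B * \<bar>b - a\<bar>"
        using assms by blast
      also have "\<dots> \<le> (\<bar>B\<bar> + 1) * (b - a)"
        using K by (intro mult_mono) auto
      finally show ?thesis using K by simp
    qed
    have "(\<Sum>K\<in>\<D>. norm (x (Sup K) - x (Inf K))) \<le> (\<bar>B\<bar> + 1) * (\<Sum>K\<in>\<D>. Sup K - Inf K)"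
      unfolding sum_distrib_left using * by (rule sum_mono)
    also have "\<dots> < (\<bar>B\<bar> + 1) * \<delta>"
      using s by (intro mult_strict_left_mono) auto
    also have "\<dots> = e" by (simp add: \<delta>_def)
    finally show ?thesis .
  qed
  ultimately show "\<exists>\<delta>>0. \<forall>d'. d' division_of \<Union>d' \<and> \<Union>d' \<subseteq> {c..d} \<and> (\<Sum>K\<in>d'. Sup K - Inf K) < \<delta> \<longrightarrow>
        (\<Sum>K\<in>d'. norm (x (Sup K) - x (Inf K))) < e"
    by blast
qed

lemma absolutely_continuous_fun_on_imp_continuous_on:
  assumes "absolutely_continuous_fun_on {c..d} x"
  shows "continuous_on {c..d} x"
  unfolding continuous_on_iff
proof (intro ballI allI impI)
  fix s e :: real assume s: "s \<in> {c..d}" and "e > 0"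
  then obtain \<delta> where "\<delta> > 0" and \<delta>: "\<And>D. D division_of \<Union>D \<Longrightarrow> \<Union>D \<subseteq> {c..d} \<Longrightarrow>
      (\<Sum>K\<in>D. Sup K - Inf K) < \<delta> \<Longrightarrow> (\<Sum>K\<in>D. norm (x (Sup K) - x (Inf K))) < e"
    using absolutely_continuous_fun_onE[OF assms(1)] by blast
  have *: "norm (x b - x a) < e" if "a \<le> b" "b - a < \<delta>" "a \<in> {c..d}" "b \<in> {c..d}" for a b
  proof -
    have "{{a..b}} division_of \<Union>{{a..b}}"
      using division_of_self[of a b] that by (simp add: box_real)
    then show ?thesis
      using \<delta>[of "{{a..b}}"] that by auto
  qed
  have "dist (x r) (x s) < e" if "r \<in> {c..d}" "dist r s < \<delta>" for r
    using *[of r s] *[of s r] that s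
    by (cases "r \<le> s") (auto simp: dist_norm norm_minus_commute)
  with \<open>\<delta> > 0\<close> show "\<exists>\<delta>>0. \<forall>r\<in>{c..d}. dist r s < \<delta> \<longrightarrow> dist (x r) (x s) < e"
    by blast
qed

text \<open>On a fine tagged division, the intervals tagged in the exceptional null set have small total
  length, so absolute continuity controls their contribution; the others obey the definition of
  the derivative.\<close>
lemma absolutely_continuous_has_integral:
  assumes "c \<le> d" and ac: "absolutely_continuous_fun_on {c..d} x"
    and der: "AE s in lebesgue. s \<in> {c..d} \<longrightarrow> (x has_vector_derivative h s) (at s within {c..d})"
  shows "(h has_integral (x d - x c)) {c..d}"
proof -
  obtain N where N: "N \<in> null_sets lebesgue"
    "\<And>s. s \<in> {c..d} \<Longrightarrow> s \<notin> N \<Longrightarrow> (x has_vector_derivative h s) (at s within {c..d})"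
    using der by (elim AE_E3) auto
  then have neg: "negligible N" by (simp add: negligible_iff_null_sets)
  \<comment> \<open>Setting the integrand to 0 on \<open>N\<close> leaves only increments of
    \<open>x\<close> over the intervals tagged there; \<open>has_integral_spike\<close> restores the
    values on the null set at the end.\<close>
  define h' where "h' = (\<lambda>s. if s \<in> N then 0 else h s)"
  have "(h' has_integral (x d - x c)) {c..d}"
    unfolding has_integral_real
  proof (intro allI impI)
    fix e :: real assume "e > 0"
    \<comment> \<open>Half of \<open>e\<close> is for tags outside \<open>N\<close>, half for tags
      inside; the summand 1 keeps the divisor positive when \<open>c = d\<close>.\<close>
    define e1 where "e1 = e / 2 / (d - c + 1)"
    have "e1 > 0" using \<open>e > 0\<close> \<open>c \<le> d\<close> by (simp add: e1_def)
    obtain \<delta> where "\<delta> > 0" and \<delta>: "\<And>D. D division_of \<Union>D \<Longrightarrow> \<Union>D \<subseteq> {c..d} \<Longrightarrow>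
        (\<Sum>K\<in>D. Sup K - Inf K) < \<delta> \<Longrightarrow> (\<Sum>K\<in>D. norm (x (Sup K) - x (Inf K))) < e / 2"
      using absolutely_continuous_fun_onE[OF ac half_gt_zero[OF \<open>e > 0\<close>]] by blast
    obtain T where T: "open T" "N \<subseteq> T" "T - N \<in> lmeasurable" "emeasure lebesgue (T - N) < ennreal \<delta>"
      using sets_lebesgue_outer_open[of N \<delta>] N(1) \<open>\<delta> > 0\<close> by blast
    have Tm: "T \<in> lmeasurable"
    proof -
      have "T = (T - N) \<union> N" using T(2) by auto
      then show ?thesis
        using fmeasurable.Un[OF T(3), of N] neg by (metis negligible_imp_measurable)
    qed
    have Tl: "measure lebesgue T < \<delta>"
    proof -
      have "measure lebesgue T = measure lebesgue (T - N)"
        by (rule measure_negligible_symdiff[symmetric])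
           (use T Tm neg in \<open>auto simp: fmeasurableD intro: negligible_subset\<close>)
      also have "\<dots> < \<delta>"
        using T(3,4) \<open>\<delta> > 0\<close> by (simp add: emeasure_eq_measure2 ennreal_less_iff)
      finally show ?thesis .
    qed
    have "\<exists>r>0. s \<in> {c..d} \<longrightarrow> s \<notin> N \<longrightarrow>
        (\<forall>y\<in>{c..d}. norm (y - s) < r \<longrightarrow> norm (x y - x s - (y - s) *\<^sub>R h s) \<le> e1 * norm (y - s))" for s
    proof (cases "s \<in> {c..d} \<and> s \<notin> N")
      case True
      then show ?thesis
        using N(2) \<open>e1 > 0\<close> unfolding has_vector_derivative_def has_derivative_within_alt by blast
    qed (auto intro: exI[of _ 1])
    then obtain r where r: "\<And>s. r s > 0" "\<And>s y. s \<in> {c..d} \<Longrightarrow> s \<notin> N \<Longrightarrow> y \<in> {c..d} \<Longrightarrow>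
        norm (y - s) < r s \<Longrightarrow> norm (x y - x s - (y - s) *\<^sub>R h s) \<le> e1 * norm (y - s)"
      by metis
    \<comment> \<open>This gauge forces every interval tagged in \<open>N\<close> into
      \<open>T\<close>, so together they are shorter than \<delta>.\<close>
    define \<gamma> where "\<gamma> s = (if s \<in> N then T else ball s (r s))" for s
    have "gauge \<gamma>"
      using T r(1) by (auto simp: gauge_def \<gamma>_def)
    moreover have "norm ((\<Sum>(s,K)\<in>\<D>. measure lborel K *\<^sub>R h' s) - (x d - x c)) < e"
      if D: "\<D> tagged_division_of {c..d}" "\<gamma> fine \<D>" for \<D>
    proof -
      define \<D>N where "\<D>N = {(s,K)\<in>\<D>. s \<in> N}"
      have fin: "finite \<D>" using D(1) by blast
      have K: "\<exists>a b. K = {a..b} \<and> a \<le> b \<and> s \<in> {a..b} \<and> a \<in> {c..d} \<and> b \<in> {c..d} \<and> s \<in> {c..d}"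
        if sK: "(s,K) \<in> \<D>" for s K
      proof -
        obtain a b where ab: "K = {a..b}"
          using tagged_division_ofD(4)[OF D(1) sK] by auto
        moreover have "s \<in> K" "K \<subseteq> {c..d}"
          using tagged_division_ofD(2,3)[OF D(1) sK] by auto
        ultimately show ?thesis
          by (intro exI[of _ a] exI[of _ b]) fastforce
      qed
      have tele: "x d - x c = (\<Sum>(s,K)\<in>\<D>. x (Sup K) - x (Inf K))"
        using additive_tagged_division_1[OF \<open>c \<le> d\<close> D(1), of x] by simp
      have eN: "(\<Sum>(s,K)\<in>\<D>N. norm (x (Sup K) - x (Inf K))) < e / 2"
      proof -
        \<comment> \<open>Absolute continuity speaks of sets of intervals, the division of tagged
          pairs. An interval carrying two different tags would have empty interior, hence be a
          single point, and then the tags agree after all.\<close>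
        have inj: "inj_on snd \<D>N"
        proof (rule inj_onI, clarify)
          fix s K s' K' assume sK: "(s,K) \<in> \<D>N" "(s',K') \<in> \<D>N" and "snd (s,K) = snd (s',K')"
          then have KK: "K' = K" by simp
          from sK have in1: "(s,K) \<in> \<D>" "(s',K) \<in> \<D>" by (auto simp: \<D>N_def KK)
          obtain a b where ab: "K = {a..b}" "a \<le> b" "s \<in> {a..b}" using K[OF in1(1)] by blast
          have s': "s' \<in> {a..b}" using K[OF in1(2)] ab by auto
          have "s = s'"
          proof (rule ccontr)
            assume "s \<noteq> s'"
            then have "interior K \<inter> interior K = {}"
              using tagged_division_ofD(5)[OF D(1) in1] by auto
            then have "a = b" using ab by (auto simp: interior_atLeastAtMost_real)
            then show False using ab s' \<open>s \<noteq> s'\<close> by auto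
          qed
          then show "s = s' \<and> K = K'" using KK by simp
        qed
        have part: "\<D>N tagged_partial_division_of {c..d}"
          using D(1) unfolding tagged_division_of_def
          by (auto simp: \<D>N_def intro: tagged_partial_division_subset)
        then have div: "snd ` \<D>N division_of \<Union>(snd ` \<D>N)"
          by (rule partial_division_of_tagged_division)
        have sub: "\<Union>(snd ` \<D>N) \<subseteq> {c..d}"
          using tagged_partial_division_ofD(3)[OF part] by fastforce
        have "(\<Sum>K\<in>snd ` \<D>N. Sup K - Inf K) = (\<Sum>K\<in>snd ` \<D>N. measure lebesgue K)"
          by (rule sum.cong) (auto simp: \<D>N_def dest!: K)
        also have "\<dots> = measure lebesgue (\<Union>(snd ` \<D>N))"
          by (rule content_division[OF div])
        also have "\<dots> \<le> measure lebesgue T"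
        proof (rule measure_mono_fmeasurable)
          show "\<Union>(snd ` \<D>N) \<subseteq> T"
            using D(2) by (fastforce simp: fine_def \<D>N_def \<gamma>_def)
          show "\<Union>(snd ` \<D>N) \<in> sets lebesgue"
            using lmeasurable_division[OF div] by (rule fmeasurableD)
        qed (rule Tm)
        finally have "(\<Sum>K\<in>snd ` \<D>N. norm (x (Sup K) - x (Inf K))) < e / 2"
          using Tl by (intro \<delta> div sub) simp
        then show ?thesis
          by (subst (asm) sum.reindex[OF inj]) (simp add: case_prod_unfold o_def)
      qed
      have eG: "norm (measure lborel K *\<^sub>R h' s - (x (Sup K) - x (Inf K))) \<le> e1 * measure lborel K"
        if sK: "(s,K) \<in> \<D> - \<D>N" for s K
      proof -
        have sK': "(s,K) \<in> \<D>" "s \<notin> N" using sK by (auto simp: \<D>N_def)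
        obtain a b where ab: "K = {a..b}" "a \<le> b" "s \<in> {a..b}" "a \<in> {c..d}" "b \<in> {c..d}" "s \<in> {c..d}"
          using K[OF sK'(1)] by blast
        have "K \<subseteq> ball s (r s)"
          using fineD[OF D(2) sK'(1)] sK'(2) by (simp add: \<gamma>_def)
        moreover have "a \<in> K" "b \<in> K" using ab by auto
        ultimately have "a \<in> ball s (r s)" "b \<in> ball s (r s)"
          by blast+
        then have 1: "norm (x a - x s - (a - s) *\<^sub>R h s) \<le> e1 * norm (a - s)"
             and 2: "norm (x b - x s - (b - s) *\<^sub>R h s) \<le> e1 * norm (b - s)"
          using ab sK'(2) by (intro r(2); simp add: dist_real_def)+
        \<comment> \<open>The increment is taken through the tag: as
          \<open>a \<le> s \<le> b\<close>, the two errors add up to \<open>e1\<close> times the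
          length of \<open>K\<close>.\<close>
        have "norm (measure lborel K *\<^sub>R h' s - (x (Sup K) - x (Inf K)))
            = norm ((x a - x s - (a - s) *\<^sub>R h s) - (x b - x s - (b - s) *\<^sub>R h s))"
          using ab sK' by (simp add: h'_def algebra_simps)
        also have "\<dots> \<le> e1 * norm (a - s) + e1 * norm (b - s)"
          using norm_triangle_ineq4 1 2 by (smt (verit))
        also have "\<dots> = e1 * measure lborel K"
          using ab by (simp add: algebra_simps)
        finally show ?thesis .
      qed
      have "(\<Sum>(s,K)\<in>\<D>. measure lborel K *\<^sub>R h' s) - (x d - x c)
          = (\<Sum>(s,K)\<in>\<D>. measure lborel K *\<^sub>R h' s - (x (Sup K) - x (Inf K)))"
        unfolding tele by (simp add: sum_subtractf case_prod_unfold)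
      also have "norm \<dots> \<le> (\<Sum>(s,K)\<in>\<D>. norm (measure lborel K *\<^sub>R h' s - (x (Sup K) - x (Inf K))))"
        unfolding case_prod_unfold by (rule norm_sum)
      also have "\<dots> = (\<Sum>(s,K)\<in>\<D> - \<D>N. norm (measure lborel K *\<^sub>R h' s - (x (Sup K) - x (Inf K))))
           + (\<Sum>(s,K)\<in>\<D>N. norm (measure lborel K *\<^sub>R h' s - (x (Sup K) - x (Inf K))))"
        by (rule sum.subset_diff) (auto simp: \<D>N_def fin)
      also have "(\<Sum>(s,K)\<in>\<D>N. norm (measure lborel K *\<^sub>R h' s - (x (Sup K) - x (Inf K))))
           = (\<Sum>(s,K)\<in>\<D>N. norm (x (Sup K) - x (Inf K)))"
        by (rule sum.cong) (auto simp: \<D>N_def h'_def norm_minus_commute)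
      also have "(\<Sum>(s,K)\<in>\<D> - \<D>N. norm (measure lborel K *\<^sub>R h' s - (x (Sup K) - x (Inf K))))
          \<le> (\<Sum>(s,K)\<in>\<D> - \<D>N. e1 * measure lborel K)"
        by (rule sum_mono) (use eG in auto)
      also have "\<dots> \<le> (\<Sum>(s,K)\<in>\<D>. e1 * measure lborel K)"
        by (rule sum_mono2) (use fin \<open>e1 > 0\<close> in auto)
      also have "\<dots> = e1 * (d - c)"
        using additive_content_tagged_division[of \<D> c d] D(1) \<open>c \<le> d\<close>
        by (simp add: sum_distrib_left[symmetric] case_prod_unfold)
      also have "\<dots> \<le> e / 2"
        using \<open>e > 0\<close> \<open>c \<le> d\<close> by (simp add: e1_def field_simps)
      finally show ?thesis using eN by linarith
    qed
    ultimately show "\<exists>\<gamma>. gauge \<gamma> \<and> (\<forall>\<D>. \<D> tagged_division_of {c..d} \<and> \<gamma> fine \<D> \<longrightarrow>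
        norm ((\<Sum>(s,K)\<in>\<D>. measure lborel K *\<^sub>R h' s) - (x d - x c)) < e)"
      by (auto intro!: exI[of _ \<gamma>])
  qed
  then show ?thesis
    by (rule has_integral_spike[OF neg, rotated]) (simp add: h'_def)
qed

section \<open>Almost-everywhere solutions and integral equations\<close>

lemma ode_solution_has_integral:
  assumes "ode_solution F c d x" "s \<in> {c..d}"
  shows "((\<lambda>r. F r (x r)) has_integral (x s - x c)) {c..s}"
proof (rule absolutely_continuous_has_integral)
  show "absolutely_continuous_fun_on {c..s} x"
    using assms by (auto simp: ode_solution_def intro: absolutely_continuous_fun_on_subset)
  show "AE r in lebesgue. r \<in> {c..s} \<longrightarrow> (x has_vector_derivative F r (x r)) (at r within {c..s})"
    using assms(1)[unfolded ode_solution_def, THEN conjunct2]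
    by eventually_elim (use assms(2) in \<open>auto intro: has_vector_derivative_within_subset\<close>)
qed (use assms in auto)

lemma ode_solution_continuous_on: "ode_solution F c d x \<Longrightarrow> continuous_on {c..d} x"
  by (simp add: ode_solution_def absolutely_continuous_fun_on_imp_continuous_on)

text \<open>A bounded velocity makes \<open>x\<close> Lipschitz, hence absolutely continuous; the
  derivative of the integral is the velocity wherever the latter is continuous, in particular off
  the finite set \<open>S\<close>.\<close>

lemma ode_solutionI:
  assumes int: "\<And>s. s \<in> {c..d} \<Longrightarrow> ((\<lambda>r. F r (x r)) has_integral (x s - x c)) {c..s}"
    and bd: "\<And>r. r \<in> {c..d} \<Longrightarrow> norm (F r (x r)) \<le> B"
    and S: "finite S" "\<And>r. r \<in> {c..d} - S \<Longrightarrow> continuous (at r within {c..d}) (\<lambda>r. F r (x r))"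
  shows "ode_solution F c d x"
  unfolding ode_solution_def
proof (intro conjI)
  define h where "h = (\<lambda>r. F r (x r))"
  have *: "norm (x s - x r) \<le> B * \<bar>s - r\<bar>" if "r \<le> s" "r \<in> {c..d}" "s \<in> {c..d}" for r s
  proof -
    have i: "h integrable_on {c..s}"
      using int[OF that(3)] unfolding h_def by blast
    have "integral {c..r} h + integral {r..s} h = integral {c..s} h"
      using that i by (intro Henstock_Kurzweil_Integration.integral_combine) auto
    moreover have "integral {c..r} h = x r - x c" "integral {c..s} h = x s - x c"
      using int that unfolding h_def by (auto intro: integral_unique)
    ultimately have "integral {r..s} h = x s - x r" by (simp add: algebra_simps)
    moreover have "h integrable_on {r..s}"
      using i by (rule integrable_subinterval_real) (use that in auto)
    ultimately have "(h has_integral (x s - x r)) (cbox r s)"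
      by (metis integrable_integral box_real(2))
    moreover have "0 \<le> B" by (rule order_trans[OF norm_ge_zero bd[OF that(2)]])
    ultimately have "norm (x s - x r) \<le> B * measure lborel (cbox r s)"
      using bd that by (intro has_integral_bound[of B h]) (auto simp: h_def)
    then show ?thesis using that by simp
  qed
  show "absolutely_continuous_fun_on {c..d} x"
  proof (rule lipschitz_imp_absolutely_continuous_fun_on)
    fix r s assume "r \<in> {c..d}" "s \<in> {c..d}"
    then show "norm (x r - x s) \<le> B * \<bar>r - s\<bar>"
      using *[of r s] *[of s r]
      by (cases "r \<le> s") (auto simp: norm_minus_commute abs_minus_commute)
  qed
  have der: "(x has_vector_derivative F s (x s)) (at s within {c..d})" if s: "s \<in> {c..d} - S" for s
  proof -
    have cd: "h integrable_on {c..d}"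
      using int[of d] s unfolding h_def by force
    have "((\<lambda>u. integral {c..u} h) has_vector_derivative h s) (at s within ({c..d} - {}))"
      using cd s S(2) by (intro integral_has_vector_derivative_continuous_at) (auto simp: h_def)
    then have "((\<lambda>u. x c + integral {c..u} h) has_vector_derivative h s) (at s within {c..d})"
      by (auto intro!: derivative_eq_intros)
    then show ?thesis
      unfolding h_def
      by (rule has_vector_derivative_transform[rotated 2])
         (use s integral_unique[OF int] in auto)
  qed
  have "AE s in lebesgue. s \<notin> S"
    using S(1) by (intro AE_not_in) (simp add: negligible_iff_null_sets[symmetric] negligible_finite)
  then show "AE s in lebesgue. s \<in> {c..d} \<longrightarrow> (x has_vector_derivative F s (x s)) (at s within {c..d})"
    by eventually_elim (use der in auto)
qed

section \<open>Gronwall's inequality and global existence\<close>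

lemma gronwall:
  fixes z :: "real \<Rightarrow> real"
  assumes cont: "continuous_on {c..d} z" and "0 \<le> L"
    and le: "\<And>s. s \<in> {c..d} \<Longrightarrow> z s \<le> K + L * integral {c..s} z"
    and s: "s \<in> {c..d}"
  shows "z s \<le> K * exp (L * (s - c))"
proof -
  define \<Phi> where "\<Phi> = (\<lambda>s. K + L * integral {c..s} z)"
  have der: "(\<Phi> has_real_derivative L * z r) (at r within {c..d})" if "r \<in> {c..d}" for r
    unfolding \<Phi>_def
    using integral_has_vector_derivative[OF cont that]
    by (auto intro!: derivative_eq_intros simp: has_real_derivative_iff_has_vector_derivative[symmetric])
  then have contPhi: "continuous_on {c..s} \<Phi>"
    using s by (intro continuous_on_subset[OF DERIV_continuous_on[OF der]]) auto
  \<comment> \<open>The majorant \<Phi> is differentiable although \<open>z\<close> need not be;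
    since \<open>z\<close> lies below \<Phi>, the product with the integrating factor cannot
    increase.\<close>
  have "exp (- L * (s - c)) * \<Phi> s \<le> exp (- L * (c - c)) * \<Phi> c"
  proof (rule DERIV_nonpos_imp_decreasing_open[where f = "\<lambda>r. exp (- L * (r - c)) * \<Phi> r"])
    fix r assume r: "c < r" "r < s"
    then have "at r within {c..d} = at r"
      using s by (intro at_within_interior) auto
    then have "((\<lambda>r. exp (- L * (r - c)) * \<Phi> r) has_real_derivative
        exp (- L * (r - c)) * (L * (z r - \<Phi> r))) (at r)"
      using der[of r] r s by (auto intro!: derivative_eq_intros simp: algebra_simps)
    moreover have "exp (- L * (r - c)) * (L * (z r - \<Phi> r)) \<le> 0"
      using le[of r] r s \<open>0 \<le> L\<close> by (intro mult_nonneg_nonpos) (auto simp: \<Phi>_def)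
    ultimately show "\<exists>y. ((\<lambda>r. exp (- L * (r - c)) * \<Phi> r) has_real_derivative y) (at r) \<and> y \<le> 0"
      by blast
  qed (use s contPhi in \<open>auto intro!: continuous_intros\<close>)
  then have *: "exp (L * (s - c)) * (exp (- L * (s - c)) * \<Phi> s) \<le> exp (L * (s - c)) * K"
    by (intro mult_left_mono) (auto simp: \<Phi>_def)
  have "exp (L * (s - c)) * (exp (- L * (s - c)) * \<Phi> s) = \<Phi> s"
    by (simp add: mult.assoc[symmetric] exp_add[symmetric])
  with * have "\<Phi> s \<le> K * exp (L * (s - c))"
    by (simp only: mult.commute)
  then show ?thesis using le[OF s] by (simp add: \<Phi>_def)
qed

text \<open>With the sup norm weighted by the factor exp (- (L + 1) (s - c)), the Picard operator is a
  contraction on the whole interval.\<close>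
lemma picard_lindeloef_global:
  fixes F :: "real \<Rightarrow> 'a::euclidean_space \<Rightarrow> 'a"
  assumes "c \<le> d" "0 \<le> L"
    and lip: "\<And>s y z. s \<in> {c..d} \<Longrightarrow> norm (F s y - F s z) \<le> L * norm (y - z)"
    and int: "\<And>y. continuous_on {c..d} y \<Longrightarrow> (\<lambda>r. F r (y r)) integrable_on {c..d}"
  obtains x where "continuous_on {c..d} x"
    and "\<And>s. s \<in> {c..d} \<Longrightarrow> ((\<lambda>r. F r (x r)) has_integral (x s - x0)) {c..s}"
proof -
  define M where "M = L + 1"
  have "M > 0" using \<open>0 \<le> L\<close> by (simp add: M_def)
  \<comment> \<open>The unknown \<open>z\<close> is the solution times the decaying weight and
    \<open>Y\<close> removes the weight, so the weighted norm becomes the ordinary sup metric of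
    bounded continuous functions.\<close>
  define Y where "Y z r = exp (M * (r - c)) *\<^sub>R apply_bcontfun z r" for z :: "real \<Rightarrow>\<^sub>C 'a" and r
  have contY: "continuous_on {c..d} (Y z)" for z
    unfolding Y_def by (intro continuous_intros continuous_on_apply_bcontfun)
  have intY: "(\<lambda>r. F r (Y z r)) integrable_on {c..s}" if "s \<in> {c..d}" for z s
    by (rule integrable_subinterval_real[OF int[OF contY]]) (use that in auto)
  define T where "T z s = exp (- M * (s - c)) *\<^sub>R (x0 + integral {c..s} (\<lambda>r. F r (Y z r)))" for z s
  have "continuous_on (cbox c d) (T z)" for z
    unfolding T_def box_real
    by (intro continuous_intros indefinite_integral_continuous_1 int contY)
  \<comment> \<open>\<open>apply_bcontfun\<close> needs a function on the whole line, so
    \<open>T z\<close> is extended by its values at the end points of \<open>{c..d}\<close>.\<close>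
  then have "\<exists>g. \<forall>s. apply_bcontfun g s = T z (clamp c d s)" for z
    by (metis continuous_on_cbox_bcontfunE)
  then obtain \<Phi> where \<Phi>: "\<And>z s. apply_bcontfun (\<Phi> z) s = T z (clamp c d s)"
    by metis
  have exp_int: "((\<lambda>r. exp (M * (r - c))) has_integral ((exp (M * (s - c)) - 1) / M)) {c..s}"
    if "c \<le> s" for s
  proof -
    have "((\<lambda>r. exp (M * (r - c)) / M) has_vector_derivative exp (M * (r - c))) (at r within {c..s})" for r
      unfolding has_real_derivative_iff_has_vector_derivative[symmetric]
      using \<open>M > 0\<close> by (auto intro!: derivative_eq_intros)
    from fundamental_theorem_of_calculus[OF that this] show ?thesis
      by (simp add: diff_divide_distrib)
  qed
  \<comment> \<open>Integrating the growing weight gives the factor 1 / M, and L / M = L / (L + 1)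
    is below 1 whatever the length of the interval.\<close>
  have "dist (\<Phi> z) (\<Phi> w) \<le> L / M * dist z w" for z w
  proof (rule dist_bound)
    fix s'
    define s where "s = clamp c d s'"
    have s: "s \<in> {c..d}" using clamp_in_interval[of c d s'] \<open>c \<le> d\<close> by (simp add: s_def)
    have "norm (integral {c..s} (\<lambda>r. F r (Y z r) - F r (Y w r)))
        \<le> integral {c..s} (\<lambda>r. (L * dist z w) * exp (M * (r - c)))"
    proof (rule integral_norm_bound_integral)
      fix r assume r: "r \<in> {c..s}"
      then have "norm (F r (Y z r) - F r (Y w r)) \<le> L * norm (Y z r - Y w r)"
        using s by (intro lip) auto
      also have "norm (Y z r - Y w r) = exp (M * (r - c)) * dist (apply_bcontfun z r) (apply_bcontfun w r)"
        by (simp add: Y_def dist_norm scaleR_diff_right[symmetric])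
      also have "L * \<dots> \<le> L * (exp (M * (r - c)) * dist z w)"
        using \<open>0 \<le> L\<close> by (intro mult_left_mono dist_bounded) auto
      finally show "norm (F r (Y z r) - F r (Y w r)) \<le> (L * dist z w) * exp (M * (r - c))"
        by (simp add: mult_ac)
    next
      show "(\<lambda>r. F r (Y z r) - F r (Y w r)) integrable_on {c..s}"
        by (intro integrable_diff intY s)
      show "(\<lambda>r. (L * dist z w) * exp (M * (r - c))) integrable_on {c..s}"
        using s by (intro integrable_on_mult_right has_integral_integrable[OF exp_int]) auto
    qed
    also have "\<dots> = L * dist z w * ((exp (M * (s - c)) - 1) / M)"
      using exp_int[of s] s by (simp add: integral_unique)
    also have "integral {c..s} (\<lambda>r. F r (Y z r) - F r (Y w r))
        = integral {c..s} (\<lambda>r. F r (Y z r)) - integral {c..s} (\<lambda>r. F r (Y w r))"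
      by (intro integral_diff intY s)
    finally have *: "norm (integral {c..s} (\<lambda>r. F r (Y z r)) - integral {c..s} (\<lambda>r. F r (Y w r)))
        \<le> L * dist z w * ((exp (M * (s - c)) - 1) / M)" .
    have "dist (apply_bcontfun (\<Phi> z) s') (apply_bcontfun (\<Phi> w) s')
        = exp (- M * (s - c)) * norm (integral {c..s} (\<lambda>r. F r (Y z r)) - integral {c..s} (\<lambda>r. F r (Y w r)))"
      by (simp add: \<Phi> T_def s_def[symmetric] dist_norm scaleR_diff_right[symmetric])
    also have "\<dots> \<le> exp (- M * (s - c)) * (L * dist z w * ((exp (M * (s - c)) - 1) / M))"
      by (intro mult_left_mono *) auto
    also have "\<dots> = L * dist z w / M * (exp (- M * (s - c)) * exp (M * (s - c)) - exp (- M * (s - c)))"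
      by (simp add: field_simps)
    also have "\<dots> = L * dist z w / M * (1 - exp (- M * (s - c)))"
      by (simp add: exp_add[symmetric])
    also have "\<dots> \<le> L * dist z w / M * 1"
      using \<open>0 \<le> L\<close> \<open>M > 0\<close> by (intro mult_left_mono) auto
    finally show "dist (apply_bcontfun (\<Phi> z) s') (apply_bcontfun (\<Phi> w) s') \<le> L / M * dist z w"
      by simp
  qed
  moreover have "0 \<le> L / M" "L / M < 1"
    using \<open>0 \<le> L\<close> by (auto simp: M_def)
  ultimately obtain z where z: "\<Phi> z = z"
    using banach_fix_type[of "L / M" \<Phi>] by blast
  have "Y z s = x0 + integral {c..s} (\<lambda>r. F r (Y z r))" if "s \<in> {c..d}" for s
  proof -
    have "Y z s = exp (M * (s - c)) *\<^sub>R T z s"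
      using that \<Phi>[of z s] by (simp add: Y_def z)
    then show ?thesis
      by (simp add: T_def exp_add[symmetric])
  qed
  then show thesis
    by (intro that[of "Y z"]) (auto simp: contY intY integrable_integral)
qed

section \<open>Functions that switch finitely often\<close>

text \<open>When the elements of a down-set are added in increasing order, the set reached just
  before \<open>j\<close> is always \<open>{..<j}\<close>, so the increment at \<open>j\<close> does
  not depend on the rest of \<open>J\<close>.\<close>

lemma telescope_down_set:
  fixes G :: "'k::{finite,linorder} set \<Rightarrow> 'b::ab_group_add"
  assumes "\<And>i j. j \<in> J \<Longrightarrow> i < j \<Longrightarrow> i \<in> J"
  shows "G J = G {} + (\<Sum>j\<in>J. G {..j} - G {..<j})"
proof -
  have "finite J" by simp
  then show ?thesis using assms
  proof (induction J rule: finite_linorder_max_induct)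
    case (insert b A)
    have A: "A = {..<b}"
      using insert.hyps insert.prems[of b] by blast
    then have ins: "insert b A = {..b}" by auto
    have "G A = G {} + (\<Sum>j\<in>A. G {..j} - G {..<j})"
      by (rule insert.IH) (use A in auto)
    moreover have "(\<Sum>j\<in>insert b A. G {..j} - G {..<j}) = (G {..b} - G A) + (\<Sum>j\<in>A. G {..j} - G {..<j})"
      using insert.hyps A by (subst sum.insert) auto
    ultimately show ?case by (simp only: ins) simp
  qed simp
qed

lemma telescope_switches:
  fixes t :: "real ^ ('k::{finite,linorder})" and G :: "'k set \<Rightarrow> 'b::ab_group_add"
  assumes "strict_mono (($) t)"
  shows "G {j. t $ j \<le> r} = G {} + (\<Sum>j\<in>UNIV. if t $ j \<le> r then G {..j} - G {..<j} else 0)"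
proof -
  have "G {j. t $ j \<le> r} = G {} + (\<Sum>j\<in>{j. t $ j \<le> r}. G {..j} - G {..<j})"
    using assms by (intro telescope_down_set) (auto dest: strict_monoD order_trans less_imp_le)
  then show ?thesis by (simp add: sum.If_cases)
qed

lemma integrable_after:
  fixes h :: "real \<Rightarrow> 'b::euclidean_space"
  assumes "h integrable_on {c..d}"
  shows "(\<lambda>r. if p \<le> r then h r else 0) integrable_on {c..d}"
proof -
  have "h integrable_on {max c p..d}"
    using assms by (rule integrable_subinterval_real) auto
  moreover have "{p..} \<inter> {c..d} = {max c p..d}" by auto
  ultimately have "(\<lambda>r. if r \<in> {p..} then h r else 0) integrable_on {c..d}"
    unfolding integrable_restrict_Int by (simp only:)
  then show ?thesis by simp
qed

text \<open>By telescoping, the function is \<open>G {}\<close> plus finitely many continuous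
  functions, each cut off before one switching time.\<close>

lemma integrable_switched:
  fixes t :: "real ^ ('k::{finite,linorder})" and G :: "'k set \<Rightarrow> real \<Rightarrow> 'b::euclidean_space"
  assumes "strict_mono (($) t)" and "\<And>J. continuous_on {c..d} (G J)"
  shows "(\<lambda>r. G {j. t $ j \<le> r} r) integrable_on {c..d}"
proof -
  have "(\<lambda>r. G {} r + (\<Sum>j\<in>UNIV. if t $ j \<le> r then G {..j} r - G {..<j} r else 0)) integrable_on {c..d}"
    by (intro integrable_add integrable_sum integrable_after integrable_diff
        integrable_continuous_real assms) auto
  then show ?thesis
    by (simp add: telescope_switches[OF assms(1), of "\<lambda>J. G J _"])
qed

text \<open>Off the switching times, the set of switchings performed is locally constant in
  \<open>s\<close>.\<close>

lemma continuous_switched: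
  fixes t :: "real ^ ('k::{finite,linorder})" and G :: "'k set \<Rightarrow> real \<Rightarrow> 'b::euclidean_space"
  assumes "continuous_on {c..d} (G {j. t $ j \<le> r})" "r \<in> {c..d} - range (($) t)"
  shows "continuous (at r within {c..d}) (\<lambda>s. G {j. t $ j \<le> s} s)"
proof -
  have "eventually (\<lambda>s. (t $ j \<le> s) = (t $ j \<le> r)) (at r within {c..d})" for j
  proof (cases "t $ j < r")
    case True
    have "eventually (\<lambda>s. t $ j < s) (at r within {c..d})"
      by (rule order_tendstoD(1)[OF tendsto_ident_at True])
    then show ?thesis by eventually_elim (use True in auto)
  next
    case False
    then have "r < t $ j" using assms(2) by (metis Diff_iff linorder_neqE rangeI)
    have "eventually (\<lambda>s. s < t $ j) (at r within {c..d})"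
      by (rule order_tendstoD(2)[OF tendsto_ident_at \<open>r < t $ j\<close>])
    then show ?thesis by eventually_elim (use \<open>r < t $ j\<close> in auto)
  qed
  then have "eventually (\<lambda>s. \<forall>j. (t $ j \<le> s) = (t $ j \<le> r)) (at r within {c..d})"
    by (rule eventually_all_finite)
  then have "eventually (\<lambda>s. G {j. t $ j \<le> r} s = G {j. t $ j \<le> s} s) (at r within {c..d})"
    by eventually_elim simp
  moreover have "(G {j. t $ j \<le> r} \<longlongrightarrow> G {j. t $ j \<le> r} r) (at r within {c..d})"
    using assms by (auto simp: continuous_on_def)
  ultimately show ?thesis
    unfolding continuous_within by (rule Lim_transform_eventually[rotated])
qed

text \<open>Together with its counterpart on the right, this identifies the one-sided limits of the
  control: the left one has seen the switchings before \<open>j\<close>, the right one also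
  \<open>j\<close> itself.\<close>

lemma eventually_switches_left:
  fixes t :: "real ^ ('k::{finite,linorder})"
  assumes "strict_mono (($) t)"
  shows "eventually (\<lambda>s. {i. t $ i \<le> s} = {..<j}) (at_left (t $ j))"
proof -
  have "eventually (\<lambda>s. i < j \<longrightarrow> t $ i < s) (at_left (t $ j))" for i
    using strict_monoD[OF assms, of i j] by (cases "i < j") (auto intro: order_tendstoD)
  then have "eventually (\<lambda>s. \<forall>i. i < j \<longrightarrow> t $ i < s) (at_left (t $ j))"
    by (rule eventually_all_finite)
  moreover have "eventually (\<lambda>s. s < t $ j) (at_left (t $ j))"
    by (auto simp: eventually_at_filter)
  ultimately show ?thesis
  proof eventually_elim
    case (elim s)
    have "i < j" if "t $ i \<le> s" for i
      using that elim assms by (metis leD leI order_trans strict_mono_less_eq)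
    then show ?case using elim by (auto intro: less_imp_le)
  qed
qed

lemma eventually_switches_right:
  fixes t :: "real ^ ('k::{finite,linorder})"
  assumes "strict_mono (($) t)"
  shows "eventually (\<lambda>s. {i. t $ i \<le> s} = {..j}) (at_right (t $ j))"
proof -
  have "eventually (\<lambda>s. j < i \<longrightarrow> s < t $ i) (at_right (t $ j))" for i
    using strict_monoD[OF assms, of j i] by (cases "j < i") (auto intro: order_tendstoD)
  then have "eventually (\<lambda>s. \<forall>i. j < i \<longrightarrow> s < t $ i) (at_right (t $ j))"
    by (rule eventually_all_finite)
  moreover have "eventually (\<lambda>s. t $ j < s) (at_right (t $ j))"
    by (auto simp: eventually_at_filter)
  ultimately show ?thesis
  proof eventually_elim
    case (elim s)
    have "i \<le> j" if "t $ i \<le> s" for i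
      using that elim by (meson leD leI)
    moreover have "t $ i \<le> s" if "i \<le> j" for i
      using that elim assms by (meson less_imp_le order_trans strict_mono_less_eq)
    ultimately show ?case by auto
  qed
qed

section \<open>Smooth fields\<close>

locale smooth_control_field =
  fixes f :: "real \<Rightarrow> 'a::euclidean_space \<Rightarrow> 'u::euclidean_space \<Rightarrow> 'a"
  assumes smooth: "smooth (\<lambda>(s, y, w). f s y w)"
begin

text \<open>The partial derivative in the state, taken from the total derivative because
  \<open>C_k\<close> gives continuity of the latter jointly in time, state and control.\<close>

definition f' :: "real \<Rightarrow> 'a \<Rightarrow> 'u \<Rightarrow> 'a \<Rightarrow> 'a" where
  "f' s y w v = frechet_derivative (\<lambda>(s, y, w). f s y w) (at (s, y, w)) (0, v, 0)"

lemma has_derivative_f: "((\<lambda>y. f s y w) has_derivative f' s y w) (at y)"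
proof -
  have "C_k 1 (\<lambda>(s, y, w). f s y w)"
    using smooth by (simp add: smooth_def)
  then have "((\<lambda>(s, y, w). f s y w) has_derivative
      frechet_derivative (\<lambda>(s, y, w). f s y w) (at (s, y, w))) (at (s, y, w))"
    unfolding One_nat_def C_k.simps frechet_derivative_works by blast
  moreover have "((\<lambda>y. (s, y, w)) has_derivative (\<lambda>v. (0, v, 0))) (at y)"
    by (auto intro!: derivative_eq_intros)
  ultimately have "((\<lambda>(s, y, w). f s y w) \<circ> (\<lambda>y. (s, y, w)) has_derivative
      frechet_derivative (\<lambda>(s, y, w). f s y w) (at (s, y, w)) \<circ> (\<lambda>v. (0, v, 0))) (at y)"
    by (intro diff_chain_at)
  then show ?thesis
    by (simp add: o_def f'_def[abs_def])
qed

lemma bounded_linear_f': "bounded_linear (f' s y w)"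
  using has_derivative_f by (rule has_derivative_bounded_linear)

lemma frechet_derivative_f: "frechet_derivative (\<lambda>y. f s y w) (at y) = f' s y w"
  using frechet_derivative_at[OF has_derivative_f] by simp

lemma continuous_on_f:
  assumes "continuous_on S \<alpha>" "continuous_on S \<beta>" "continuous_on S \<gamma>"
  shows "continuous_on S (\<lambda>r. f (\<alpha> r) (\<beta> r) (\<gamma> r))"
proof -
  have "C_k 0 (\<lambda>(s, y, w). f s y w)"
    using smooth unfolding smooth_def by blast
  then have "continuous_on UNIV (\<lambda>(s, y, w). f s y w)" by simp
  then have "continuous_on S (\<lambda>r. (\<lambda>(s, y, w). f s y w) (\<alpha> r, \<beta> r, \<gamma> r))"
    by (rule continuous_on_compose2) (auto intro!: continuous_intros assms)
  then show ?thesis by simp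
qed

lemma continuous_on_f':
  assumes "continuous_on S \<alpha>" "continuous_on S \<beta>" "continuous_on S \<gamma>" "continuous_on S \<nu>"
  shows "continuous_on S (\<lambda>r. f' (\<alpha> r) (\<beta> r) (\<gamma> r) (\<nu> r))"
proof -
  have "C_k 1 (\<lambda>(s, y, w). f s y w)"
    using smooth by (simp add: smooth_def)
  then have "continuous_on UNIV (\<lambda>p. frechet_derivative (\<lambda>(s, y, w). f s y w) (at p) (0, v, 0))" for v
    by simp
  then have *: "continuous_on S (\<lambda>r. f' (\<alpha> r) (\<beta> r) (\<gamma> r) v)" for v
    unfolding f'_def
    by (rule continuous_on_compose2[where f = "\<lambda>r. (\<alpha> r, \<beta> r, \<gamma> r)"])
       (auto intro!: continuous_intros assms)
  \<comment> \<open>\<open>C_k\<close> gives continuity for a fixed direction only; expansion in the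
    basis transfers it to the moving direction \<nu>.\<close>
  have "f' s y w v = (\<Sum>b\<in>Basis. (v \<bullet> b) *\<^sub>R f' s y w b)" for s y w v
    by (subst euclidean_representation[of v, symmetric])
       (simp add: bounded_linear_f' linear_sum linear_cmul bounded_linear.linear)
  then have "(\<lambda>r. f' (\<alpha> r) (\<beta> r) (\<gamma> r) (\<nu> r))
      = (\<lambda>r. \<Sum>b\<in>Basis. (\<nu> r \<bullet> b) *\<^sub>R f' (\<alpha> r) (\<beta> r) (\<gamma> r) b)" by blast
  moreover have "continuous_on S (\<lambda>r. \<Sum>b\<in>Basis. (\<nu> r \<bullet> b) *\<^sub>R f' (\<alpha> r) (\<beta> r) (\<gamma> r) b)"
    by (intro continuous_intros * assms)
  ultimately show ?thesis by (simp only:)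
qed

text \<open>The operator norm is at most the sum of the norms of the images of the basis vectors,
  which is continuous and so bounded on the compact product.\<close>

lemma f'_bounded:
  assumes "compact C" "compact K"
  obtains L where "0 \<le> L"
    "\<And>s w y. s \<in> {c..d} \<Longrightarrow> w \<in> C \<Longrightarrow> y \<in> K \<Longrightarrow> onorm (f' s y w) \<le> L"
proof -
  define g where "g = (\<lambda>(s, y, w). \<Sum>b\<in>Basis. norm (f' s y w b))"
  have "continuous_on ({c..d} \<times> K \<times> C) g"
    unfolding g_def case_prod_unfold by (intro continuous_intros continuous_on_f')
  then have "bounded (g ` ({c..d} \<times> K \<times> C))"
    by (intro compact_imp_bounded compact_continuous_image compact_Times assms) auto
  then obtain B where B: "\<And>p. p \<in> {c..d} \<times> K \<times> C \<Longrightarrow> norm (g p) \<le> B"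
    unfolding bounded_iff by blast
  show thesis
  proof (rule that[of "max B 0"])
    fix s w y assume "s \<in> {c..d}" "w \<in> C" "y \<in> K"
    then have "g (s, y, w) \<le> B" using B[of "(s, y, w)"] by auto
    moreover have "onorm (f' s y w) \<le> g (s, y, w)"
      unfolding g_def by (simp add: onorm_componentwise bounded_linear_f')
    ultimately show "onorm (f' s y w) \<le> max B 0" by simp
  qed simp
qed

lemma f_lipschitz:
  assumes "convex K" "\<And>y. y \<in> K \<Longrightarrow> onorm (f' s y w) \<le> L" "y \<in> K" "z \<in> K"
  shows "norm (f s y w - f s z w) \<le> L * norm (y - z)"
  by (rule differentiable_bound[OF assms(1) _ assms(2-4)])
     (rule has_derivative_at_withinI[OF has_derivative_f])

lemma f_linearization:
  assumes "compact C" "compact K" "convex K" "\<epsilon> > 0"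
  obtains \<delta> where "\<delta> > 0"
    "\<And>s w y z. s \<in> {c..d} \<Longrightarrow> w \<in> C \<Longrightarrow> y \<in> K \<Longrightarrow> z \<in> K \<Longrightarrow> norm (z - y) < \<delta> \<Longrightarrow>
       norm (f s z w - f s y w - f' s y w (z - y)) \<le> \<epsilon> * norm (z - y)"
proof -
  \<comment> \<open>\<open>g\<close> vanishes for \<open>z = y\<close> and dominates the operator
    norm of the change of the derivative; uniform continuity makes it small near the diagonal with
    one \<delta> for all times and controls.\<close>
  define g where "g = (\<lambda>(s, w, y, z). \<Sum>b\<in>Basis. norm (f' s z w b - f' s y w b))"
  have "continuous_on ({c..d} \<times> C \<times> K \<times> K) g"
    unfolding g_def case_prod_unfold by (intro continuous_intros continuous_on_f')
  then have "uniformly_continuous_on ({c..d} \<times> C \<times> K \<times> K) g"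
    by (intro compact_uniformly_continuous compact_Times assms) auto
  then obtain \<delta> where "\<delta> > 0" and \<delta>: "\<And>p q. p \<in> {c..d} \<times> C \<times> K \<times> K \<Longrightarrow> q \<in> {c..d} \<times> C \<times> K \<times> K \<Longrightarrow>
      dist q p < \<delta> \<Longrightarrow> dist (g q) (g p) < \<epsilon>"
    using \<open>\<epsilon> > 0\<close> unfolding uniformly_continuous_on_def by metis
  have "norm (f s z w - f s y w - f' s y w (z - y)) \<le> norm (z - y) * \<epsilon>"
    if s: "s \<in> {c..d}" "w \<in> C" and yz: "y \<in> K" "z \<in> K" "norm (z - y) < \<delta>" for s w y z
  proof (rule differentiable_bound_linearization[where f = "\<lambda>y. f s y w" and f' = "\<lambda>y. f' s y w"
          and S = "closed_segment y z" and ?x0.0 = y])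
      show "y + \<tau> *\<^sub>R (z - y) \<in> closed_segment y z" if \<tau>: "\<tau> \<in> {0..1}" for \<tau>
        using \<tau> by (auto simp: closed_segment_def algebra_simps intro!: exI[of _ \<tau>])
      show "y \<in> closed_segment y z" by simp
      fix \<xi> assume \<xi>: "\<xi> \<in> closed_segment y z"
      show "((\<lambda>y. f s y w) has_derivative f' s \<xi> w) (at \<xi> within closed_segment y z)"
        by (rule has_derivative_at_withinI[OF has_derivative_f])
      have "\<xi> \<in> K"
        using \<xi> closed_segment_subset[OF yz(1,2) assms(3)] by blast
      moreover have "norm (\<xi> - y) < \<delta>"
        using \<xi> yz(3) segment_bound1[of \<xi> y z] by simp
      ultimately have "dist (g (s, w, y, \<xi>)) (g (s, w, y, y)) < \<epsilon>"
        by (intro \<delta>) (use s yz in \<open>auto simp: dist_Pair_Pair dist_norm\<close>)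
      then have "g (s, w, y, \<xi>) < \<epsilon>" by (simp add: g_def dist_norm)
      moreover have "bounded_linear (f' s \<xi> w - f' s y w)"
        unfolding fun_diff_def by (rule bounded_linear_sub[OF bounded_linear_f' bounded_linear_f'])
      then have "onorm (f' s \<xi> w - f' s y w) \<le> (\<Sum>b\<in>Basis. norm ((f' s \<xi> w - f' s y w) b))"
        by (rule onorm_componentwise)
      ultimately show "onorm (f' s \<xi> w - f' s y w) \<le> \<epsilon>"
        by (simp add: g_def)
  qed
  then show thesis
    using \<open>\<delta> > 0\<close> by (intro that[of \<delta>]) (simp_all add: mult.commute)
qed

end

section \<open>Trajectories and their dependence on the switching times\<close>

text \<open>The inner \<open>max 0 p\<close> admits negative \<open>p\<close>, which can occur later
  as a switching time minus \<rho>.\<close>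

lemma has_integral_step:
  fixes p s :: real
  assumes "0 \<le> s"
  shows "((\<lambda>r. of_bool (p \<le> r)) has_integral max 0 (s - max 0 p)) {0..s}"
proof -
  have "((\<lambda>r. 1::real) has_integral max 0 (s - max 0 p)) {max 0 p..s}"
    using has_integral_const_real[of "1::real" "max 0 p" s] by (simp add: max_def split: if_splits)
  moreover have "{p..} \<inter> {0..s} = {max 0 p..s}" by auto
  ultimately have "((\<lambda>r. if r \<in> {p..} then 1 else (0::real)) has_integral max 0 (s - max 0 p)) {0..s}"
    unfolding has_integral_restrict_Int by (simp only:)
  moreover have "(\<lambda>r. if r \<in> {p..} then 1 else (0::real)) = (\<lambda>r. of_bool (p \<le> r))" by auto
  ultimately show ?thesis by (simp only:)
qed

text \<open>The integrand is the indicator of the gap between \<open>p\<close> and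
  \<open>q\<close>.\<close>

lemma abs_step_diff:
  fixes p q s :: real
  assumes "0 \<le> s"
  shows integrable_abs_step_diff: "(\<lambda>r. \<bar>of_bool (p \<le> r) - of_bool (q \<le> r)\<bar> :: real) integrable_on {0..s}"
    and integral_abs_step_diff: "integral {0..s} (\<lambda>r. \<bar>of_bool (p \<le> r) - of_bool (q \<le> r)\<bar> :: real) \<le> \<bar>p - q\<bar>"
proof -
  have *: "((\<lambda>r. \<bar>of_bool (p \<le> r) - of_bool (q \<le> r)\<bar>) has_integral
      (max 0 (s - max 0 p) - max 0 (s - max 0 q))) {0..s}" if "p \<le> q" for p q :: real
  proof -
    have "(\<lambda>r. \<bar>of_bool (p \<le> r) - of_bool (q \<le> r)\<bar>) = (\<lambda>r. of_bool (p \<le> r) - of_bool (q \<le> r) :: real)"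
      using that by (auto simp: fun_eq_iff)
    then show ?thesis
      using has_integral_diff[OF has_integral_step[OF assms, of p] has_integral_step[OF assms, of q]] by simp
  qed
  have sym: "(\<lambda>r. \<bar>of_bool (p \<le> r) - of_bool (q \<le> r)\<bar>) = (\<lambda>r. \<bar>of_bool (q \<le> r) - of_bool (p \<le> r)\<bar> :: real)"
    by (simp add: abs_minus_commute)
  consider "p \<le> q" | "q \<le> p" by linarith
  then have "\<exists>i\<le>\<bar>p - q\<bar>. ((\<lambda>r. \<bar>of_bool (p \<le> r) - of_bool (q \<le> r)\<bar>) has_integral i) {0..s}"
  proof cases
    case 1
    then have "max 0 (s - max 0 p) - max 0 (s - max 0 q) \<le> \<bar>p - q\<bar>" by (simp add: max_def)
    with *[OF 1] show ?thesis by blast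
  next
    case 2
    then have "max 0 (s - max 0 q) - max 0 (s - max 0 p) \<le> \<bar>p - q\<bar>" by (simp add: max_def)
    with *[OF 2] show ?thesis unfolding sym by blast
  qed
  then obtain i where "i \<le> \<bar>p - q\<bar>"
    "((\<lambda>r. \<bar>of_bool (p \<le> r) - of_bool (q \<le> r)\<bar>) has_integral i) {0..s}" by blast
  then show "(\<lambda>r. \<bar>of_bool (p \<le> r) - of_bool (q \<le> r)\<bar> :: real) integrable_on {0..s}"
    and "integral {0..s} (\<lambda>r. \<bar>of_bool (p \<le> r) - of_bool (q \<le> r)\<bar> :: real) \<le> \<bar>p - q\<bar>"
    by (auto simp: integral_unique)
qed

text \<open>Both telescoping sums have the same increments, so only the indicators differ. This is
  an identity at every \<open>r\<close>, however many gaps between old and new times overlap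
  there.\<close>

lemma switched_diff:
  fixes t t' :: "real ^ ('k::{finite,linorder})" and G :: "'k set \<Rightarrow> 'b::real_vector"
  assumes "strict_mono (($) t)" "strict_mono (($) t')"
  shows "G {j. t' $ j \<le> r} - G {j. t $ j \<le> r}
    = (\<Sum>j\<in>UNIV. (of_bool (t' $ j \<le> r) - of_bool (t $ j \<le> r)) *\<^sub>R (G {..j} - G {..<j}))"
  unfolding telescope_switches[OF assms(1), of G r] telescope_switches[OF assms(2), of G r]
  by (simp add: sum_subtractf[symmetric]) (rule sum.cong; simp)

text \<open>The control enters only through the value \<open>W J\<close> that it takes after the set \<open>J\<close> of
  switchings has been performed.\<close>
locale switched_system = smooth_control_field f
  for f :: "real \<Rightarrow> 'a::euclidean_space \<Rightarrow> 'u::euclidean_space \<Rightarrow> 'a" +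
  fixes W :: "'k::{finite,linorder} set \<Rightarrow> 'u" and tf :: real and x0 :: 'a
  assumes tf_pos: "0 < tf"
begin

definition control :: "(real, 'k) vec \<Rightarrow> real \<Rightarrow> 'u" where
  "control t s = W {j. t $ j \<le> s}"

text \<open>The field is a parameter so that the same estimates serve \<open>f\<close> and its
  truncation. At \<open>s = 0\<close> the integral vanishes, which encodes the initial
  condition.\<close>

definition integral_solution :: "(real \<Rightarrow> 'a \<Rightarrow> 'u \<Rightarrow> 'a) \<Rightarrow> (real, 'k) vec \<Rightarrow> (real \<Rightarrow> 'a) \<Rightarrow> bool" where
  "integral_solution g t x \<longleftrightarrow> continuous_on {0..tf} x \<and>
     (\<forall>s\<in>{0..tf}. ((\<lambda>r. g r (x r) (control t r)) has_integral (x s - x0)) {0..s})"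

lemma compact_range_W: "compact (range W)"
  by (intro finite_imp_compact) simp

lemma control_in_range: "control t s \<in> range W"
  by (simp add: control_def)

lemma integral_solution_0:
  assumes "integral_solution g t x"
  shows "x 0 = x0"
proof -
  have "((\<lambda>r. g r (x r) (control t r)) has_integral (x 0 - x0)) {0..0}"
    using assms tf_pos unfolding integral_solution_def by (auto dest: bspec[of _ _ 0])
  moreover have "((\<lambda>r. g r (x r) (control t r)) has_integral 0) {0..0}"
    by (simp add: has_integral_refl)
  ultimately have "x 0 - x0 = 0" by (rule has_integral_unique)
  then show ?thesis by simp
qed

text \<open>Only the values of the field along \<open>x\<close> matter; this is the passage between
  \<open>f\<close> and its truncation.\<close>

lemma integral_solution_cong:
  assumes "integral_solution g t x" "\<And>r w. r \<in> {0..tf} \<Longrightarrow> h r (x r) w = g r (x r) w"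
  shows "integral_solution h t x"
  unfolding integral_solution_def
proof (intro conjI ballI)
  show "continuous_on {0..tf} x" using assms(1) by (simp add: integral_solution_def)
  fix s assume s: "s \<in> {0..tf}"
  have "((\<lambda>r. g r (x r) (control t r)) has_integral (x s - x0)) {0..s}"
    using assms(1) s by (simp add: integral_solution_def)
  then show "((\<lambda>r. h r (x r) (control t r)) has_integral (x s - x0)) {0..s}"
    by (rule has_integral_eq[rotated]) (use s assms(2) in auto)
qed

lemma bounded_along:
  assumes "continuous_on {0..tf} x"
  obtains B where "0 \<le> B" "\<And>r J. r \<in> {0..tf} \<Longrightarrow> norm (f r (x r) (W J)) \<le> B"
proof -
  have "bounded ((\<lambda>p. f (fst p) (x (fst p)) (snd p)) ` ({0..tf} \<times> range W))"
    by (intro compact_imp_bounded compact_continuous_image continuous_on_f compact_Times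
          compact_range_W continuous_on_compose2[OF assms] continuous_intros) auto
  then obtain B where "\<And>p. p \<in> {0..tf} \<times> range W \<Longrightarrow> norm (f (fst p) (x (fst p)) (snd p)) \<le> B"
    unfolding bounded_iff by blast
  then have B: "norm (f r (x r) (W J)) \<le> B" if "r \<in> {0..tf}" for r J
    using that by fastforce
  show thesis
    by (rule that[of "max B 0"]) (use B in \<open>auto intro: order_trans[OF _ max.cobounded1]\<close>)
qed

text \<open>Backwards, \<open>ode_solutionI\<close> applies because the velocity is bounded along
  \<open>x\<close> and continuous off the switching times.\<close>

lemma solution_iff:
  "ode_solution (\<lambda>s y. f s y (control t s)) 0 tf x \<and> x 0 = x0 \<longleftrightarrow> integral_solution f t x"
proof
  assume "ode_solution (\<lambda>s y. f s y (control t s)) 0 tf x \<and> x 0 = x0"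
  then have ode: "ode_solution (\<lambda>s y. f s y (control t s)) 0 tf x" and "x 0 = x0" by auto
  show "integral_solution f t x"
    unfolding integral_solution_def
  proof (intro conjI ballI)
    show "continuous_on {0..tf} x" by (rule ode_solution_continuous_on[OF ode])
    show "((\<lambda>r. f r (x r) (control t r)) has_integral (x s - x0)) {0..s}" if "s \<in> {0..tf}" for s
      using ode_solution_has_integral[OF ode that] unfolding \<open>x 0 = x0\<close> .
  qed
next
  assume sol: "integral_solution f t x"
  then have x: "continuous_on {0..tf} x" by (simp add: integral_solution_def)
  obtain B where "0 \<le> B" and B: "\<And>r J. r \<in> {0..tf} \<Longrightarrow> norm (f r (x r) (W J)) \<le> B"
    using bounded_along[OF x] by blast
  have "ode_solution (\<lambda>s y. f s y (control t s)) 0 tf x"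
  proof (rule ode_solutionI)
    show "finite (range (($) t))" by simp
    show "norm (f r (x r) (control t r)) \<le> B" if "r \<in> {0..tf}" for r
      using B[OF that] by (simp add: control_def)
    show "((\<lambda>r. f r (x r) (control t r)) has_integral x s - x 0) {0..s}" if "s \<in> {0..tf}" for s
      using sol that integral_solution_0[OF sol] by (simp add: integral_solution_def)
    show "continuous (at r within {0..tf}) (\<lambda>r. f r (x r) (control t r))"
      if "r \<in> {0..tf} - range (($) t)" for r
      unfolding control_def
      by (rule continuous_switched[where G = "\<lambda>J r. f r (x r) (W J)",
            OF continuous_on_f[OF continuous_on_id x continuous_on_const] that])
  qed
  with integral_solution_0[OF sol]
  show "ode_solution (\<lambda>s y. f s y (control t s)) 0 tf x \<and> x 0 = x0" by simp
qed

text \<open>Inserting \<open>g r (x r) (control t' r)\<close> separates the change of control, at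
  most \<open>2 * B\<close> during a gap of length \<open>\<bar>t' $ j - t $ j\<bar>\<close>, from
  the change of state, controlled by \<open>L\<close>. The change of control is evaluated along
  \<open>x\<close>, so \<open>B\<close> concerns the reference trajectory only.\<close>

lemma integral_solution_perturbation:
  assumes mono: "strict_mono (($) t)" "strict_mono (($) t')"
    and sol: "integral_solution g t x" "integral_solution g t' y"
    and L: "0 \<le> L" "\<And>r y z w. r \<in> {0..tf} \<Longrightarrow> w \<in> range W \<Longrightarrow> norm (g r y w - g r z w) \<le> L * norm (y - z)"
    and B: "\<And>r J. r \<in> {0..tf} \<Longrightarrow> norm (g r (x r) (W J)) \<le> B"
    and s: "s \<in> {0..tf}"
  shows "norm (y s - x s) \<le> (\<Sum>j\<in>UNIV. 2 * B * \<bar>t' $ j - t $ j\<bar>) * exp (L * s)"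
proof -
  have cont: "continuous_on {0..tf} (\<lambda>s. norm (y s - x s))"
    using sol by (auto simp: integral_solution_def intro!: continuous_intros)
  have "0 \<le> B" using B[OF s] norm_ge_zero order_trans by blast
  have "norm (y s - x s) \<le> (\<Sum>j\<in>UNIV. 2 * B * \<bar>t' $ j - t $ j\<bar>) * exp (L * (s - 0))"
  proof (rule gronwall[OF cont L(1) _ s])
    fix s assume s: "s \<in> {0..tf}"
    define \<sigma> where "\<sigma> j r = (\<bar>of_bool (t' $ j \<le> r) - of_bool (t $ j \<le> r)\<bar> :: real)" for j r
    have \<sigma>_int: "\<sigma> j integrable_on {0..s}" "integral {0..s} (\<sigma> j) \<le> \<bar>t' $ j - t $ j\<bar>" for j
      unfolding \<sigma>_def using s by (auto intro: integrable_abs_step_diff integral_abs_step_diff)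
    have n_int: "(\<lambda>r. norm (y r - x r)) integrable_on {0..s}"
      by (rule integrable_continuous_real, rule continuous_on_subset[OF cont]) (use s in auto)
    have "((\<lambda>r. g r (y r) (control t' r) - g r (x r) (control t r)) has_integral
        ((y s - x0) - (x s - x0))) {0..s}"
      using sol s by (intro has_integral_diff) (auto simp: integral_solution_def)
    then have int: "(\<lambda>r. g r (y r) (control t' r) - g r (x r) (control t r)) integrable_on {0..s}"
      and eq: "y s - x s = integral {0..s} (\<lambda>r. g r (y r) (control t' r) - g r (x r) (control t r))"
      by (auto simp: integral_unique)
    have int_sum: "integral {0..s} (\<lambda>r. \<Sum>j\<in>UNIV. 2 * B * \<sigma> j r) = (\<Sum>j\<in>UNIV. 2 * B * integral {0..s} (\<sigma> j))"
      by (subst integral_sum) (auto intro!: integrable_on_mult_right \<sigma>_int)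
    have "norm (y s - x s) \<le> integral {0..s} (\<lambda>r. L * norm (y r - x r) + (\<Sum>j\<in>UNIV. 2 * B * \<sigma> j r))"
      unfolding eq
    proof (rule integral_norm_bound_integral[OF int])
      show "(\<lambda>r. L * norm (y r - x r) + (\<Sum>j\<in>UNIV. 2 * B * \<sigma> j r)) integrable_on {0..s}"
        by (intro integrable_add integrable_sum integrable_on_mult_right n_int \<sigma>_int) auto
      fix r assume "r \<in> {0..s}"
      then have r: "r \<in> {0..tf}" using s by auto
      have "norm (g r (x r) (control t' r) - g r (x r) (control t r)) \<le> (\<Sum>j\<in>UNIV. 2 * B * \<sigma> j r)"
        unfolding control_def switched_diff[OF mono, of "\<lambda>J. g r (x r) (W J)"]
      proof (rule sum_norm_le)
        fix j
        have "norm (g r (x r) (W {..j}) - g r (x r) (W {..<j})) \<le> B + B"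
          by (rule order_trans[OF norm_triangle_ineq4 add_mono[OF B[OF r] B[OF r]]])
        then show "norm ((of_bool (t' $ j \<le> r) - of_bool (t $ j \<le> r)) *\<^sub>R
            (g r (x r) (W {..j}) - g r (x r) (W {..<j}))) \<le> 2 * B * \<sigma> j r"
          unfolding norm_scaleR \<sigma>_def real_norm_def by (subst mult.commute) (intro mult_right_mono; simp)
      qed
      moreover have "norm (g r (y r) (control t' r) - g r (x r) (control t' r)) \<le> L * norm (y r - x r)"
        using L(2)[OF r control_in_range] .
      ultimately show "norm (g r (y r) (control t' r) - g r (x r) (control t r))
          \<le> L * norm (y r - x r) + (\<Sum>j\<in>UNIV. 2 * B * \<sigma> j r)"
        by (smt (verit) norm_triangle_ineq diff_add_cancel add_diff_eq)
    qed
    also have "\<dots> = L * integral {0..s} (\<lambda>r. norm (y r - x r)) + (\<Sum>j\<in>UNIV. 2 * B * integral {0..s} (\<sigma> j))"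
      by (subst integral_add) (auto intro!: integrable_sum integrable_on_mult_right n_int \<sigma>_int simp: int_sum)
    also have "(\<Sum>j\<in>UNIV. 2 * B * integral {0..s} (\<sigma> j)) \<le> (\<Sum>j\<in>UNIV. 2 * B * \<bar>t' $ j - t $ j\<bar>)"
      using \<open>0 \<le> B\<close> by (intro sum_mono mult_left_mono \<sigma>_int) auto
    finally show "norm (y s - x s) \<le> (\<Sum>j\<in>UNIV. 2 * B * \<bar>t' $ j - t $ j\<bar>)
        + L * integral {0..s} (\<lambda>r. norm (y r - x r))" by simp
  qed
  then show ?thesis by simp
qed

text \<open>Outside the ball of radius R the field is replaced by its value at the nearest point of the
  ball; the result is globally Lipschitz and agrees with f inside the ball.\<close>
definition truncated :: "real \<Rightarrow> real \<Rightarrow> 'a \<Rightarrow> 'u \<Rightarrow> 'a" where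
  "truncated R r y w = f r (closest_point (cball 0 R) y) w"

lemma truncated_eq: "norm y \<le> R \<Longrightarrow> truncated R r y w = f r y w"
  by (simp add: truncated_def closest_point_self)

text \<open>The projection onto a ball does not increase distances, and inside the ball the bounded
  derivative of \<open>f\<close> gives a Lipschitz constant.\<close>

lemma truncated_lipschitz:
  assumes "0 \<le> R"
  obtains L where "0 \<le> L" "\<And>r y z w. r \<in> {0..tf} \<Longrightarrow> w \<in> range W \<Longrightarrow>
    norm (truncated R r y w - truncated R r z w) \<le> L * norm (y - z)"
proof -
  obtain L where L: "0 \<le> L" "\<And>s w y. s \<in> {0..tf} \<Longrightarrow> w \<in> range W \<Longrightarrow> y \<in> cball 0 R \<Longrightarrow> onorm (f' s y w) \<le> L"
    using f'_bounded[OF compact_range_W compact_cball] by blast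
  show thesis
  proof (rule that[OF L(1)])
    fix r y z w assume rw: "r \<in> {0..tf}" "w \<in> range W"
    let ?P = "closest_point (cball (0::'a) R)"
    have P: "?P y \<in> cball 0 R" for y
      using assms by (intro closest_point_in_set) auto
    have "norm (truncated R r y w - truncated R r z w) \<le> L * norm (?P y - ?P z)"
      unfolding truncated_def
      by (rule f_lipschitz[OF convex_cball _ P P]) (rule L(2)[OF rw])
    also have "\<dots> \<le> L * norm (y - z)"
      using closest_point_lipschitz[of "cball (0::'a) R" y z] assms L(1)
      by (intro mult_left_mono) (auto simp: dist_norm)
    finally show "norm (truncated R r y w - truncated R r z w) \<le> L * norm (y - z)" .
  qed
qed

lemma truncated_solution_exists:
  assumes "strict_mono (($) t)" "0 \<le> R"
  obtains y where "integral_solution (truncated R) t y"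
proof -
  obtain L where L: "0 \<le> L" "\<And>r y z w. r \<in> {0..tf} \<Longrightarrow> w \<in> range W \<Longrightarrow>
      norm (truncated R r y w - truncated R r z w) \<le> L * norm (y - z)"
    using truncated_lipschitz[OF assms(2)] by blast
  have "(\<lambda>r. truncated R r (y r) (control t r)) integrable_on {0..tf}" if "continuous_on {0..tf} y" for y
    unfolding control_def truncated_def
    by (rule integrable_switched[OF assms(1)],
        intro continuous_on_f continuous_intros continuous_on_compose2[OF continuous_on_closest_point that])
       (use assms(2) in auto)
  moreover have "norm (truncated R r y (control t r) - truncated R r z (control t r)) \<le> L * norm (y - z)"
    if "r \<in> {0..tf}" for r y z
    using L(2)[OF that control_in_range] .
  ultimately obtain y where "continuous_on {0..tf} y"
    "\<And>s. s \<in> {0..tf} \<Longrightarrow> ((\<lambda>r. truncated R r (y r) (control t r)) has_integral (y s - x0)) {0..s}"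
    using picard_lindeloef_global[OF less_imp_le[OF tf_pos] L(1), of "\<lambda>r y. truncated R r y (control t r)" x0]
    by blast
  then show thesis
    by (intro that[of y]) (simp add: integral_solution_def)
qed

lemma integral_solution_bounded:
  assumes "integral_solution g t x"
  obtains R where "\<And>r. r \<in> {0..tf} \<Longrightarrow> norm (x r) \<le> R"
proof -
  have "bounded (x ` {0..tf})"
    using assms by (intro compact_imp_bounded compact_continuous_image) (auto simp: integral_solution_def)
  then show thesis using that unfolding bounded_iff by blast
qed

text \<open>In a ball containing both trajectories \<open>f\<close> agrees with its truncation, and
  for equal switching times the perturbation estimate has right-hand side 0.\<close>

lemma solution_unique:
  assumes "strict_mono (($) t)" "integral_solution f t x" "integral_solution f t y" "s \<in> {0..tf}"
  shows "y s = x s"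
proof -
  obtain R1 where R1: "\<And>r. r \<in> {0..tf} \<Longrightarrow> norm (x r) \<le> R1"
    using integral_solution_bounded[OF assms(2)] by blast
  obtain R2 where R2: "\<And>r. r \<in> {0..tf} \<Longrightarrow> norm (y r) \<le> R2"
    using integral_solution_bounded[OF assms(3)] by blast
  define R where "R = max 0 (max R1 R2)"
  have R: "norm (x r) \<le> R" "norm (y r) \<le> R" if "r \<in> {0..tf}" for r
    using R1[OF that] R2[OF that] by (auto simp: R_def)
  obtain L where L: "0 \<le> L" "\<And>r y z w. r \<in> {0..tf} \<Longrightarrow> w \<in> range W \<Longrightarrow>
      norm (truncated R r y w - truncated R r z w) \<le> L * norm (y - z)"
    using truncated_lipschitz[of R] by (auto simp: R_def)
  have contx: "continuous_on {0..tf} x" using assms(2) by (simp add: integral_solution_def)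
  obtain B where "0 \<le> B" and B: "\<And>r J. r \<in> {0..tf} \<Longrightarrow> norm (f r (x r) (W J)) \<le> B"
    using bounded_along[OF contx] by blast
  have "norm (y s - x s) \<le> (\<Sum>j\<in>UNIV. 2 * B * \<bar>t $ j - t $ j\<bar>) * exp (L * s)"
    by (rule integral_solution_perturbation[OF assms(1,1) _ _ L])
       (use assms R B in \<open>auto intro!: integral_solution_cong[of f] simp: truncated_eq\<close>)
  then show ?thesis by simp
qed

text \<open>The truncated system has a global solution for \<open>t'\<close>. As \<open>R\<close>
  exceeds the bound on \<open>x\<close> by 1, a solution within distance 1 of \<open>x\<close> never
  meets the truncation and so solves the original system.\<close>

lemma solution_stable:
  assumes "strict_mono (($) t)" "integral_solution f t x"
  shows "\<exists>R C \<delta>. 0 < \<delta> \<and> 0 \<le> C \<and> (\<forall>r\<in>{0..tf}. norm (x r) \<le> R) \<and>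
    (\<forall>t'. strict_mono (($) t') \<and> norm (t' - t) < \<delta> \<longrightarrow>
      (\<exists>y. integral_solution f t' y \<and>
        (\<forall>r\<in>{0..tf}. norm (y r) \<le> R \<and> norm (y r - x r) \<le> C * norm (t' - t))))"
proof -
  obtain R1 where R1: "\<And>r. r \<in> {0..tf} \<Longrightarrow> norm (x r) \<le> R1"
    using integral_solution_bounded[OF assms(2)] by blast
  define R where "R = max 0 R1 + 1"
  have R: "norm (x r) \<le> R - 1" if "r \<in> {0..tf}" for r
    using R1[OF that] by (auto simp: R_def)
  have "0 \<le> R" by (simp add: R_def)
  obtain L where L: "0 \<le> L" "\<And>r y z w. r \<in> {0..tf} \<Longrightarrow> w \<in> range W \<Longrightarrow>
      norm (truncated R r y w - truncated R r z w) \<le> L * norm (y - z)"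
    using truncated_lipschitz[OF \<open>0 \<le> R\<close>] by blast
  have contx: "continuous_on {0..tf} x" using assms(2) by (simp add: integral_solution_def)
  obtain B where B: "0 \<le> B" "\<And>r J. r \<in> {0..tf} \<Longrightarrow> norm (f r (x r) (W J)) \<le> B"
    using bounded_along[OF contx] by blast
  \<comment> \<open>Each of the \<open>CARD('k)\<close> gaps costs a velocity change of at most
    \<open>2 * B\<close>, amplified by the Gronwall factor.\<close>
  define C where "C = real CARD('k) * (2 * B) * exp (L * tf)"
  have "0 \<le> C" using B by (simp add: C_def)
  show ?thesis
  proof (rule exI[of _ R], rule exI[of _ C], rule exI[of _ "1 / (C + 1)"], intro conjI allI impI ballI)
    fix t' assume t': "strict_mono (($) t') \<and> norm (t' - t) < 1 / (C + 1)"
    then have mono: "strict_mono (($) t')" and d: "norm (t' - t) < 1 / (C + 1)" by auto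
    obtain y where y: "integral_solution (truncated R) t' y"
      using truncated_solution_exists[OF mono \<open>0 \<le> R\<close>] by blast
    have x: "integral_solution (truncated R) t x"
      using assms(2) R by (auto intro!: integral_solution_cong[of f] truncated_eq order_trans[OF R])
    have yx: "norm (y s - x s) \<le> C * norm (t' - t)" if s: "s \<in> {0..tf}" for s
    proof -
      have "norm (y s - x s) \<le> (\<Sum>j\<in>UNIV. 2 * B * \<bar>t' $ j - t $ j\<bar>) * exp (L * s)"
        by (rule integral_solution_perturbation[OF assms(1) mono x y L _ s])
           (use B R in \<open>auto simp: truncated_eq order_trans[OF R]\<close>)
      also have "\<dots> \<le> (\<Sum>j\<in>(UNIV::'k set). 2 * B * norm (t' - t)) * exp (L * tf)"
        using s L(1) B(1) component_le_norm_cart[of "t' - t"]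
        by (intro mult_mono sum_mono mult_left_mono sum_nonneg) (auto intro: mult_left_mono)
      also have "\<dots> = C * norm (t' - t)" by (simp add: C_def)
      finally show ?thesis .
    qed
    \<comment> \<open>The radius \<open>1 / (C + 1)\<close> is chosen for this: the deviation fits
      into the margin 1 left in \<open>R\<close>.\<close>
    have "C * norm (t' - t) \<le> 1"
    proof -
      have "norm (t' - t) + C * norm (t' - t) < 1" using d \<open>0 \<le> C\<close> by (simp add: field_simps)
      then show ?thesis using norm_ge_zero[of "t' - t"] by linarith
    qed
    then have yR: "norm (y r) \<le> R" if "r \<in> {0..tf}" for r
      using yx[OF that] R[OF that] norm_triangle_sub[of "y r" "x r"] by linarith
    then have "integral_solution f t' y"
      using y by (auto intro!: integral_solution_cong[of "truncated R"] simp: truncated_eq)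
    then show "\<exists>y. integral_solution f t' y \<and>
        (\<forall>r\<in>{0..tf}. norm (y r) \<le> R \<and> norm (y r - x r) \<le> C * norm (t' - t))"
      using yR yx by blast
  qed (use \<open>0 \<le> C\<close> R in \<open>auto intro: order_trans[OF R]\<close>)
qed

end

section \<open>First-order expansion in the switching times\<close>

lemma has_integral_step_diff:
  fixes p q s :: real
  assumes "0 \<le> s" "0 \<le> p" "0 \<le> q"
  shows "((\<lambda>r. of_bool (p \<le> r) - of_bool (q \<le> r)) has_integral (max 0 (s - p) - max 0 (s - q))) {0..s}"
  using has_integral_diff[OF has_integral_step[OF assms(1), of p] has_integral_step[OF assms(1), of q]] assms(2,3)
  by (simp add: max_absorb2)

text \<open>Once \<open>s\<close> has passed both \<open>p\<close> and \<open>q\<close> the integral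
  is exactly \<open>q - p\<close>, and before both it is 0; an error of at most \<rho> remains only
  for \<open>s\<close> within \<rho> of \<open>p\<close>. The window may exclude its right end,
  since \<open>p\<close> and \<open>q\<close> are both passed there.\<close>

lemma step_diff_error:
  fixes p q s \<rho> :: real
  assumes "\<bar>q - p\<bar> \<le> \<rho>"
  shows "\<bar>max 0 (s - p) - max 0 (s - q) - of_bool (p \<le> s) * (q - p)\<bar>
    \<le> \<rho> * \<bar>of_bool (p - \<rho> \<le> s) - of_bool (p + \<rho> \<le> s)\<bar>"
  using assms by (auto simp: max_def abs_if split: if_splits)

context switched_system
begin

text \<open>Earlier minus later velocity: delaying the switching prolongs the earlier control
  value.\<close>

definition jump :: "(real \<Rightarrow> 'a) \<Rightarrow> 'k \<Rightarrow> real \<Rightarrow> 'a" where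
  "jump x j r = f r (x r) (W {..<j}) - f r (x r) (W {..j})"

definition variation :: "(real, 'k) vec \<Rightarrow> (real \<Rightarrow> 'a) \<Rightarrow> 'k \<Rightarrow> (real \<Rightarrow> 'a) \<Rightarrow> bool" where
  "variation t x j v \<longleftrightarrow> v (t $ j) = jump x j (t $ j) \<and>
     (\<forall>s\<in>{t $ j..tf}. ((\<lambda>r. f' r (x r) (control t r) (v r)) has_integral (v s - v (t $ j))) {t $ j..s})"

lemma continuous_on_jump: "continuous_on S x \<Longrightarrow> continuous_on S (jump x j)"
  unfolding jump_def by (intro continuous_intros continuous_on_f)

text \<open>Extending \<open>v\<close> by 0 to the left puts all variations on one interval. The
  extension jumps at \<open>t $ j\<close>, so its initial value must be subtracted to obtain the
  primitive.\<close>

lemma variation_has_integral: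
  assumes "variation t x j v" "0 \<le> t $ j" "s \<in> {0..tf}"
  shows "((\<lambda>r. if t $ j \<le> r then f' r (x r) (control t r) (v r) else 0) has_integral
    (if t $ j \<le> s then v s - jump x j (t $ j) else 0)) {0..s}"
proof (cases "t $ j \<le> s")
  case True
  then have "((\<lambda>r. f' r (x r) (control t r) (v r)) has_integral (v s - jump x j (t $ j))) {t $ j..s}"
    using assms unfolding variation_def by auto
  moreover have "{t $ j..} \<inter> {0..s} = {t $ j..s}" using assms(2) by auto
  ultimately have "((\<lambda>r. if r \<in> {t $ j..} then f' r (x r) (control t r) (v r) else 0) has_integral
      (v s - jump x j (t $ j))) {0..s}"
    unfolding has_integral_restrict_Int by (simp only:)
  then show ?thesis using True by simp
next
  case False
  have "((\<lambda>r. 0) has_integral (0::'a)) {0..s}" by simp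
  then have "((\<lambda>r. if t $ j \<le> r then f' r (x r) (control t r) (v r) else 0) has_integral 0) {0..s}"
    by (rule has_integral_eq[rotated]) (use False in auto)
  then show ?thesis using False by simp
qed

text \<open>The remainder that appears when a switching time moves from \<open>t $ j\<close> to \<open>t' $ j\<close>: it is of
  second order except while \<open>s\<close> is between the two, where it is of first order.\<close>
lemma switching_error:
  fixes k :: "real \<Rightarrow> 'a"
  assumes p: "0 \<le> p" "0 \<le> q" "p \<in> {0..tf}" and s: "s \<in> {0..tf}" and pq: "\<bar>q - p\<bar> \<le> \<rho>"
    and int: "(\<lambda>r. (of_bool (p \<le> r) - of_bool (q \<le> r)) *\<^sub>R k r) integrable_on {0..s}"
    and k: "\<And>r. r \<in> {0..tf} \<Longrightarrow> \<bar>r - p\<bar> \<le> \<rho> \<Longrightarrow> norm (k r - c) \<le> e"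
  shows "norm (integral {0..s} (\<lambda>r. (of_bool (p \<le> r) - of_bool (q \<le> r)) *\<^sub>R k r)
      - (of_bool (p \<le> s) * (q - p)) *\<^sub>R c)
    \<le> e * \<rho> + norm c * (\<rho> * \<bar>of_bool (p - \<rho> \<le> s) - of_bool (p + \<rho> \<le> s)\<bar>)"
proof -
  define \<sigma> where "\<sigma> r = (of_bool (p \<le> r) - of_bool (q \<le> r) :: real)" for r
  have "0 \<le> s" using s by simp
  have "0 \<le> \<rho>" using pq by linarith
  have "0 \<le> e" using order_trans[OF norm_ge_zero k[OF p(3)]] \<open>0 \<le> \<rho>\<close> by simp
  have \<sigma>: "(\<sigma> has_integral (max 0 (s - p) - max 0 (s - q))) {0..s}"
    unfolding \<sigma>_def by (rule has_integral_step_diff) (use p s in auto)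
  have \<sigma>c: "((\<lambda>r. \<sigma> r *\<^sub>R c) has_integral ((max 0 (s - p) - max 0 (s - q)) *\<^sub>R c)) {0..s}"
    using \<sigma> by (rule has_integral_scaleR_left)
  have \<sigma>k: "(\<lambda>r. \<sigma> r *\<^sub>R k r) integrable_on {0..s}" using int unfolding \<sigma>_def .
  have \<sigma>abs: "(\<lambda>r. \<bar>\<sigma> r\<bar>) integrable_on {0..s}" "integral {0..s} (\<lambda>r. \<bar>\<sigma> r\<bar>) \<le> \<rho>"
    using integrable_abs_step_diff[OF \<open>0 \<le> s\<close>, of p q] integral_abs_step_diff[OF \<open>0 \<le> s\<close>, of p q] pq
    unfolding \<sigma>_def by (auto simp: abs_minus_commute)
  have "norm (integral {0..s} (\<lambda>r. \<sigma> r *\<^sub>R k r - \<sigma> r *\<^sub>R c)) \<le> integral {0..s} (\<lambda>r. e * \<bar>\<sigma> r\<bar>)"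
  proof (rule integral_norm_bound_integral)
    show "(\<lambda>r. \<sigma> r *\<^sub>R k r - \<sigma> r *\<^sub>R c) integrable_on {0..s}"
      using \<sigma>k has_integral_integrable[OF \<sigma>c] by (rule integrable_diff)
    show "(\<lambda>r. e * \<bar>\<sigma> r\<bar>) integrable_on {0..s}"
      by (intro integrable_on_mult_right \<sigma>abs)
    fix r assume r: "r \<in> {0..s}"
    show "norm (\<sigma> r *\<^sub>R k r - \<sigma> r *\<^sub>R c) \<le> e * \<bar>\<sigma> r\<bar>"
    proof (cases "\<sigma> r = 0")
      case False
      \<comment> \<open>Where \<sigma> does not vanish, \<open>r\<close> lies between
        \<open>p\<close> and \<open>q\<close>, so replacing \<open>k r\<close> by \<open>c\<close>
        costs at most \<open>e\<close>.\<close>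
      then have "\<bar>r - p\<bar> \<le> \<rho>" using pq by (cases "p \<le> r"; cases "q \<le> r") (auto simp: \<sigma>_def)
      then have "norm (k r - c) \<le> e" using r s by (intro k) auto
      then have "\<bar>\<sigma> r\<bar> * norm (k r - c) \<le> \<bar>\<sigma> r\<bar> * e" by (intro mult_left_mono) auto
      then show ?thesis
        by (simp add: scaleR_diff_right[symmetric] mult.commute)
    qed simp
  qed
  also have "\<dots> \<le> e * \<rho>"
    using \<sigma>abs \<open>0 \<le> e\<close> by (simp add: mult_left_mono)
  finally have 1: "norm (integral {0..s} (\<lambda>r. \<sigma> r *\<^sub>R k r) - (max 0 (s - p) - max 0 (s - q)) *\<^sub>R c) \<le> e * \<rho>"
    using integral_diff[OF \<sigma>k has_integral_integrable[OF \<sigma>c]] integral_unique[OF \<sigma>c] by simp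
  have "norm ((max 0 (s - p) - max 0 (s - q) - of_bool (p \<le> s) * (q - p)) *\<^sub>R c)
      \<le> norm c * (\<rho> * \<bar>of_bool (p - \<rho> \<le> s) - of_bool (p + \<rho> \<le> s)\<bar>)"
    unfolding norm_scaleR real_norm_def
    by (subst mult.commute) (intro mult_left_mono step_diff_error pq norm_ge_zero)
  \<comment> \<open>Freezing \<open>k\<close> at \<open>c\<close> costs \<open>e * \<rho>\<close>;
    replacing the signed length of the gap up to \<open>s\<close> by its final value costs the
    window term.\<close>
  with 1 have "norm ((integral {0..s} (\<lambda>r. \<sigma> r *\<^sub>R k r) - (max 0 (s - p) - max 0 (s - q)) *\<^sub>R c)
      + (max 0 (s - p) - max 0 (s - q) - of_bool (p \<le> s) * (q - p)) *\<^sub>R c)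
      \<le> e * \<rho> + norm c * (\<rho> * \<bar>of_bool (p - \<rho> \<le> s) - of_bool (p + \<rho> \<le> s)\<bar>)"
    by (intro order_trans[OF norm_triangle_ineq] add_mono)
  then show ?thesis
    unfolding \<sigma>_def[abs_def] by (simp add: algebra_simps)
qed

text \<open>The factor in front of \<open>\<epsilon> * \<rho>\<close> contains neither
  \<open>t'\<close> nor \<epsilon>, so \<epsilon> can be chosen after it.\<close>

lemma endpoint_expansion:
  assumes mono: "strict_mono (($) t)" "strict_mono (($) t')"
    and times: "\<And>j. 0 < t $ j \<and> t $ j < tf" "\<And>j. 0 < t' $ j \<and> t' $ j < tf"
    and sol: "integral_solution f t x" "integral_solution f t' y"
    and var: "\<And>j. variation t x j (v j)"
    and R: "\<And>r. r \<in> {0..tf} \<Longrightarrow> x r \<in> cball 0 R" "\<And>r. r \<in> {0..tf} \<Longrightarrow> y r \<in> cball 0 R"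
    and L: "0 \<le> L" "\<And>s w y. s \<in> {0..tf} \<Longrightarrow> w \<in> range W \<Longrightarrow> y \<in> cball 0 R \<Longrightarrow> onorm (f' s y w) \<le> L"
    and \<rho>: "\<rho> = norm (t' - t)" "\<rho> \<le> \<epsilon>" "\<And>j. t $ j + \<rho> \<le> tf"
    and yx: "0 \<le> C" "\<And>r. r \<in> {0..tf} \<Longrightarrow> norm (y r - x r) \<le> C * \<rho>"
    and lin: "\<And>r w. r \<in> {0..tf} \<Longrightarrow> w \<in> range W \<Longrightarrow>
       norm (f r (y r) w - f r (x r) w - f' r (x r) w (y r - x r)) \<le> \<epsilon> * norm (y r - x r)"
    and jmp: "\<And>j r. r \<in> {0..tf} \<Longrightarrow> \<bar>r - t $ j\<bar> \<le> \<rho> \<Longrightarrow> norm (jump y j r - jump x j (t $ j)) \<le> \<epsilon>"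
  shows "norm (y tf - x tf - (\<Sum>j\<in>UNIV. (t' $ j - t $ j) *\<^sub>R v j tf))
    \<le> ((C * tf + L * (CARD('k) * tf + 2 * (\<Sum>j\<in>UNIV. norm (jump x j (t $ j))))) * exp (L * tf) + CARD('k))
      * \<epsilon> * \<rho>"
proof -
  have "0 \<le> \<rho>" by (simp add: \<rho>(1))
  have "0 \<le> \<epsilon>" using \<open>0 \<le> \<rho>\<close> \<rho>(2) by linarith
  define u where "u = control t"
  define u' where "u' = control t'"
  define \<eta> where "\<eta> j = t' $ j - t $ j" for j
  have \<eta>: "\<bar>\<eta> j\<bar> \<le> \<rho>" for j
    using component_le_norm_cart[of "t' - t" j] by (simp add: \<rho> \<eta>_def)
  define c where "c j = jump x j (t $ j)" for j
  define A where "A r = f' r (x r) (u r)" for r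
  have A: "linear (A r)" for r
    unfolding A_def using bounded_linear_f' by (rule bounded_linear.linear)
  have A_le: "norm (A r z) \<le> L * norm z" if "r \<in> {0..tf}" for r z
    unfolding A_def u_def
    by (rule order_trans[OF onorm[OF bounded_linear_f']
          mult_right_mono[OF L(2)[OF that control_in_range R(1)[OF that]] norm_ge_zero]])
  \<comment> \<open>Each summand is 0 before \<open>t $ j\<close> and jumps there, so the primitive
    of \<open>A r (V r)\<close> below is \<open>V\<close> without the jumps
    \<open>\<eta> j *\<^sub>R c j\<close>.\<close>
  define V where "V r = (\<Sum>j\<in>UNIV. \<eta> j *\<^sub>R (if t $ j \<le> r then v j r else 0))" for r
  have AV: "((\<lambda>r. A r (V r)) has_integral
      (\<Sum>j\<in>UNIV. \<eta> j *\<^sub>R (if t $ j \<le> s then v j s - c j else 0))) {0..s}" if "s \<in> {0..tf}" for s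
  proof -
    have "((\<lambda>r. \<Sum>j\<in>UNIV. \<eta> j *\<^sub>R (if t $ j \<le> r then f' r (x r) (control t r) (v j r) else 0)) has_integral
      (\<Sum>j\<in>UNIV. \<eta> j *\<^sub>R (if t $ j \<le> s then v j s - c j else 0))) {0..s}"
      unfolding c_def using that times(1)
      by (intro has_integral_sum has_integral_cmul variation_has_integral var) (auto intro: less_imp_le)
    moreover have "A r (V r) = (\<Sum>j\<in>UNIV. \<eta> j *\<^sub>R (if t $ j \<le> r then f' r (x r) (control t r) (v j r) else 0))" for r
      unfolding V_def linear_sum[OF A] linear_cmul[OF A]
      by (intro sum.cong refl) (simp add: A_def u_def linear_0[OF bounded_linear.linear[OF bounded_linear_f']])
    ultimately show ?thesis by (simp only:)
  qed
  have fy': "((\<lambda>r. f r (y r) (u' r)) has_integral (y s - x0)) {0..s}" if "s \<in> {0..tf}" for s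
    using sol(2) that by (simp add: integral_solution_def u'_def)
  have fx: "((\<lambda>r. f r (x r) (u r)) has_integral (x s - x0)) {0..s}" if "s \<in> {0..tf}" for s
    using sol(1) that by (simp add: integral_solution_def u_def)
  have cont: "continuous_on {0..tf} x" "continuous_on {0..tf} y"
    using sol by (auto simp: integral_solution_def)
  have fy: "(\<lambda>r. f r (y r) (u r)) integrable_on {0..s}" if "s \<in> {0..tf}" for s
    unfolding u_def control_def
    by (rule integrable_switched[where G = "\<lambda>J r. f r (y r) (W J)", OF mono(1)],
        rule continuous_on_subset[OF continuous_on_f[OF continuous_on_id cont(2) continuous_on_const]])
       (use that in auto)
  \<comment> \<open>The control is \<open>u\<close> in both velocities, so \<open>I\<close> contains
    only the response to the change of state; the change of control is left to
    \<open>q\<close>.\<close>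
  define I where "I r = f r (y r) (u r) - f r (x r) (u r) - A r (V r)" for r
  have I_int: "I integrable_on {0..s}" if "s \<in> {0..tf}" for s
    unfolding I_def using that by (intro integrable_diff fy has_integral_integrable[OF fx] has_integral_integrable[OF AV])
  define Z where "Z s = integral {0..s} I" for s
  have Zcont: "continuous_on {0..tf} Z"
    unfolding Z_def using I_int[of tf] tf_pos by (intro indefinite_integral_continuous_1) auto
  \<comment> \<open>Here the effect of the changed control meets the jumps of \<open>V\<close>; the
    two cancel to first order outside short windows.\<close>
  define q where "q s = y s - x s - V s - Z s" for s
  \<comment> \<open>\<open>\<tau> j\<close> is the indicator of a window of length
    \<open>2 * \<rho>\<close> around \<open>t $ j\<close>, where this cancellation may fail.\<close>
  define \<tau> where "\<tau> j s = \<bar>of_bool (t $ j - \<rho> \<le> s) - of_bool (t $ j + \<rho> \<le> s) :: real\<bar>" for j s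
  define e where "e s = (\<Sum>j\<in>UNIV. \<epsilon> * \<rho> + norm (c j) * (\<rho> * \<tau> j s))" for s
  have q_le: "norm (q s) \<le> e s" if s: "s \<in> {0..tf}" for s
  proof -
    have ji: "(\<lambda>r. (of_bool (t $ j \<le> r) - of_bool (t' $ j \<le> r)) *\<^sub>R jump y j r) integrable_on {0..s}" for j
    proof -
      have "jump y j integrable_on {0..s}"
        by (rule integrable_continuous_real, rule continuous_on_subset[OF continuous_on_jump[OF cont(2)]])
           (use s in auto)
      then have "(\<lambda>r. (if t $ j \<le> r then jump y j r else 0) - (if t' $ j \<le> r then jump y j r else 0))
          integrable_on {0..s}"
        by (intro integrable_diff integrable_after)
      moreover have "(\<lambda>r. (if t $ j \<le> r then jump y j r else 0) - (if t' $ j \<le> r then jump y j r else 0))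
          = (\<lambda>r. (of_bool (t $ j \<le> r) - of_bool (t' $ j \<le> r)) *\<^sub>R jump y j r)"
        by (auto simp: fun_eq_iff)
      ultimately show ?thesis by (simp only:)
    qed
    have "q s = (y s - x0) - (x s - x0) - V s
        - (integral {0..s} (\<lambda>r. f r (y r) (u r)) - (x s - x0)
           - (\<Sum>j\<in>UNIV. \<eta> j *\<^sub>R (if t $ j \<le> s then v j s - c j else 0)))"
      unfolding q_def Z_def I_def
      by (simp add: integral_diff integrable_diff fy[OF s] has_integral_integrable[OF fx[OF s]]
          has_integral_integrable[OF AV[OF s]] integral_unique[OF fx[OF s]] integral_unique[OF AV[OF s]])
    also have "\<dots> = (y s - x0 - integral {0..s} (\<lambda>r. f r (y r) (u r)))
        - (V s - (\<Sum>j\<in>UNIV. \<eta> j *\<^sub>R (if t $ j \<le> s then v j s - c j else 0)))"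
      by (simp add: algebra_simps)
    also have "V s - (\<Sum>j\<in>UNIV. \<eta> j *\<^sub>R (if t $ j \<le> s then v j s - c j else 0))
        = (\<Sum>j\<in>UNIV. (of_bool (t $ j \<le> s) * (t' $ j - t $ j)) *\<^sub>R c j)"
      unfolding V_def sum_subtractf[symmetric]
      by (intro sum.cong refl) (auto simp: \<eta>_def algebra_simps)
    also have "y s - x0 - integral {0..s} (\<lambda>r. f r (y r) (u r))
        = integral {0..s} (\<lambda>r. f r (y r) (u' r) - f r (y r) (u r))"
      using integral_diff[OF has_integral_integrable[OF fy'[OF s]] fy[OF s]] integral_unique[OF fy'[OF s]] by simp
    also have "(\<lambda>r. f r (y r) (u' r) - f r (y r) (u r))
        = (\<lambda>r. \<Sum>j\<in>UNIV. (of_bool (t $ j \<le> r) - of_bool (t' $ j \<le> r)) *\<^sub>R jump y j r)"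
      unfolding u_def u'_def control_def
    proof
      fix r
      show "f r (y r) (W {j. t' $ j \<le> r}) - f r (y r) (W {j. t $ j \<le> r})
          = (\<Sum>j\<in>UNIV. (of_bool (t $ j \<le> r) - of_bool (t' $ j \<le> r)) *\<^sub>R jump y j r)"
        unfolding switched_diff[OF mono, of "\<lambda>J. f r (y r) (W J)"]
        by (intro sum.cong refl) (simp add: jump_def algebra_simps)
    qed
    also have "integral {0..s} \<dots>
        = (\<Sum>j\<in>UNIV. integral {0..s} (\<lambda>r. (of_bool (t $ j \<le> r) - of_bool (t' $ j \<le> r)) *\<^sub>R jump y j r))"
      by (rule integral_sum) (auto intro: ji)
    finally have "q s = (\<Sum>j\<in>UNIV.
        integral {0..s} (\<lambda>r. (of_bool (t $ j \<le> r) - of_bool (t' $ j \<le> r)) *\<^sub>R jump y j r)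
        - (of_bool (t $ j \<le> s) * (t' $ j - t $ j)) *\<^sub>R c j)"
      by (simp add: sum_subtractf)
    also have "norm \<dots> \<le> e s"
      unfolding e_def
    proof (rule sum_norm_le)
      fix j
      show "norm (integral {0..s} (\<lambda>r. (of_bool (t $ j \<le> r) - of_bool (t' $ j \<le> r)) *\<^sub>R jump y j r)
        - (of_bool (t $ j \<le> s) * (t' $ j - t $ j)) *\<^sub>R c j) \<le> \<epsilon> * \<rho> + norm (c j) * (\<rho> * \<tau> j s)"
        unfolding \<tau>_def
        by (rule switching_error[OF _ _ _ s _ ji])
           (use times[of j] \<eta>[of j] jmp[of _ j] in \<open>auto simp: c_def \<eta>_def\<close>)
    qed
    finally show ?thesis .
  qed
  have \<tau>_int: "\<tau> j integrable_on {0..s}" "integral {0..s} (\<tau> j) \<le> 2 * \<rho>" if "s \<in> {0..tf}" for j s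
    using integrable_abs_step_diff[of s "t $ j - \<rho>" "t $ j + \<rho>"]
      integral_abs_step_diff[of s "t $ j - \<rho>" "t $ j + \<rho>"] that \<open>0 \<le> \<rho>\<close>
    unfolding \<tau>_def by auto
  have e_int: "(e has_integral (\<Sum>j\<in>UNIV. \<epsilon> * \<rho> * s + norm (c j) * (\<rho> * integral {0..s} (\<tau> j)))) {0..s}"
    if "s \<in> {0..tf}" for s
    unfolding e_def
    by (intro has_integral_sum has_integral_add has_integral_mult_right integrable_integral \<tau>_int that)
       (use that has_integral_const_real[of "\<epsilon> * \<rho>" 0 s] in \<open>auto simp: mult.commute\<close>)
  define E where "E = (CARD('k) * tf + 2 * (\<Sum>j\<in>UNIV. norm (c j))) * \<epsilon> * \<rho>"
  have e_le: "integral {0..s} e \<le> E" if s: "s \<in> {0..tf}" for s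
  proof -
    have "integral {0..s} e = (\<Sum>j\<in>UNIV. \<epsilon> * \<rho> * s + norm (c j) * (\<rho> * integral {0..s} (\<tau> j)))"
      using e_int[OF s] by (rule integral_unique)
    \<comment> \<open>A window has length \<open>2 * \<rho>\<close> and height proportional to
      \<rho>; one factor \<rho> is traded for \<epsilon>.\<close>
    also have "\<dots> \<le> (\<Sum>j\<in>UNIV. \<epsilon> * \<rho> * tf + norm (c j) * (\<rho> * (2 * \<epsilon>)))"
    proof (intro sum_mono add_mono mult_left_mono)
      fix j show "integral {0..s} (\<tau> j) \<le> 2 * \<epsilon>"
        using \<tau>_int(2)[OF s, of j] \<rho>(2) by linarith
    qed (use s \<open>0 \<le> \<epsilon>\<close> \<open>0 \<le> \<rho>\<close> in auto)
    also have "\<dots> = E"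
      by (simp add: E_def sum.distrib sum_distrib_left sum_distrib_right algebra_simps)
    finally show ?thesis .
  qed
  define K where "K = \<epsilon> * C * \<rho> * tf + L * E"
  have "norm (Z tf) \<le> K * exp (L * (tf - 0))"
  proof (rule gronwall[OF continuous_on_norm[OF Zcont] L(1)])
    fix s assume s: "s \<in> {0..tf}"
    have Zn: "(\<lambda>r. norm (Z r)) integrable_on {0..s}"
      by (rule integrable_continuous_real, rule continuous_on_subset[OF continuous_on_norm[OF Zcont]])
         (use s in auto)
    have cint: "((\<lambda>r. \<epsilon> * C * \<rho>) has_integral \<epsilon> * C * \<rho> * s) {0..s}"
      using has_integral_const_real[of "\<epsilon> * C * \<rho>" 0 s] s by (simp add: mult.commute)
    have bnd: "((\<lambda>r. \<epsilon> * C * \<rho> + L * e r + L * norm (Z r)) has_integral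
        (\<epsilon> * C * \<rho> * s + L * integral {0..s} e + L * integral {0..s} (\<lambda>r. norm (Z r)))) {0..s}"
      by (intro has_integral_add cint has_integral_mult_right integrable_integral Zn
          has_integral_integrable[OF e_int[OF s]])
    have "norm (Z s) \<le> integral {0..s} (\<lambda>r. \<epsilon> * C * \<rho> + L * e r + L * norm (Z r))"
      unfolding Z_def[of s]
    proof (rule integral_norm_bound_integral[OF I_int[OF s] has_integral_integrable[OF bnd]])
      fix r assume "r \<in> {0..s}"
      then have r: "r \<in> {0..tf}" using s by auto
      \<comment> \<open>Subtracting \<open>A r (V r)\<close> leaves only \<open>Z r + q r\<close>
        under the linear map, so \<open>q\<close> acts on \<open>Z\<close> through the integral of
        its bound \<open>e\<close> alone.\<close>
      have VZ: "y r - x r = V r + (Z r + q r)" by (simp add: q_def)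
      have "I r = (f r (y r) (u r) - f r (x r) (u r) - A r (y r - x r)) + A r (Z r + q r)"
        unfolding I_def VZ linear_add[OF A, of _ "V r"] by simp
      also have "norm \<dots> \<le> \<epsilon> * norm (y r - x r) + L * norm (Z r + q r)"
        unfolding A_def u_def
        by (intro order_trans[OF norm_triangle_ineq] add_mono lin[OF r control_in_range]
            A_le[OF r, unfolded A_def u_def])
      also have "\<dots> \<le> \<epsilon> * (C * \<rho>) + L * (norm (Z r) + e r)"
        using yx(2)[OF r] q_le[OF r] \<open>0 \<le> \<epsilon>\<close> L(1) norm_triangle_ineq[of "Z r" "q r"]
        by (intro add_mono mult_left_mono) auto
      finally show "norm (I r) \<le> \<epsilon> * C * \<rho> + L * e r + L * norm (Z r)"
        by (simp add: algebra_simps)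
    qed
    also have "\<dots> = \<epsilon> * C * \<rho> * s + L * integral {0..s} e + L * integral {0..s} (\<lambda>r. norm (Z r))"
      using bnd by (rule integral_unique)
    also have "\<dots> \<le> K + L * integral {0..s} (\<lambda>r. norm (Z r))"
      unfolding K_def using s \<open>0 \<le> \<epsilon>\<close> \<open>0 \<le> \<rho>\<close> yx(1) L(1)
      by (intro add_mono mult_left_mono e_le) auto
    finally show "norm (Z s) \<le> K + L * integral {0..s} (\<lambda>r. norm (Z r))" .
  qed (use tf_pos in auto)
  moreover have "norm (q tf) \<le> CARD('k) * \<epsilon> * \<rho>"
  proof -
    \<comment> \<open>By \<open>t $ j + \<rho> \<le> tf\<close> all windows have closed at the final
      time, so no first-order remainder survives.\<close>
    have "\<tau> j tf = 0" for j
      using \<rho>(3)[of j] \<open>0 \<le> \<rho>\<close> by (simp add: \<tau>_def)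
    then have "e tf = CARD('k) * \<epsilon> * \<rho>" by (simp add: e_def)
    then show ?thesis using q_le[of tf] tf_pos by simp
  qed
  moreover have "y tf - x tf - (\<Sum>j\<in>UNIV. (t' $ j - t $ j) *\<^sub>R v j tf) = Z tf + q tf"
    using times(1) by (simp add: q_def V_def \<eta>_def less_imp_le)
  moreover have "K * exp (L * tf) + CARD('k) * \<epsilon> * \<rho>
      = ((C * tf + L * (CARD('k) * tf + 2 * (\<Sum>j\<in>UNIV. norm (jump x j (t $ j))))) * exp (L * tf) + CARD('k))
      * \<epsilon> * \<rho>"
    by (simp add: K_def E_def c_def algebra_simps)
  ultimately show ?thesis
    using norm_triangle_ineq[of "Z tf" "q tf"] by simp
qed

section \<open>Solvability of the variational equations\<close>

lemma ode_solution_variation: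
  assumes "ode_solution (\<lambda>r w. f' r (x r) (control t r) w) (t $ j) tf v" "v (t $ j) = jump x j (t $ j)"
  shows "variation t x j v"
  unfolding variation_def using assms ode_solution_has_integral[OF assms(1)] by blast

text \<open>The linearized field is globally Lipschitz, its coefficients being bounded along the
  compact image of \<open>x\<close>; hence the solution reaches \<open>tf\<close>.\<close>

lemma variation_exists:
  assumes mono: "strict_mono (($) t)" and tj: "0 < t $ j" "t $ j < tf" and cont: "continuous_on {0..tf} x"
  shows "\<exists>v. ode_solution (\<lambda>r w. f' r (x r) (control t r) w) (t $ j) tf v \<and> v (t $ j) = jump x j (t $ j)"
proof -
  have cont_x: "continuous_on {t $ j..tf} x"
    using tj by (intro continuous_on_subset[OF cont]) auto
  have "compact (x ` {0..tf})" by (intro compact_continuous_image cont) simp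
  then obtain L where L: "0 \<le> L"
    "\<And>s w y. s \<in> {0..tf} \<Longrightarrow> w \<in> range W \<Longrightarrow> y \<in> x ` {0..tf} \<Longrightarrow> onorm (f' s y w) \<le> L"
    using f'_bounded[OF compact_range_W] by blast
  define F where "F = (\<lambda>r w. f' r (x r) (control t r) w)"
  have F_le: "norm (F r z) \<le> L * norm z" if "r \<in> {t $ j..tf}" for r z
    unfolding F_def
    by (rule order_trans[OF onorm[OF bounded_linear_f']
          mult_right_mono[OF L(2)[OF _ control_in_range] norm_ge_zero]])
       (use that tj in auto)
  have F_diff: "F r y - F r z = F r (y - z)" for r y z
    unfolding F_def by (simp add: linear_diff bounded_linear.linear bounded_linear_f')
  have "(\<lambda>r. F r (z r)) integrable_on {t $ j..tf}" if "continuous_on {t $ j..tf} z" for z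
    unfolding F_def control_def
    by (rule integrable_switched[where G = "\<lambda>J r. f' r (x r) (W J) (z r)", OF mono])
       (intro continuous_on_f' continuous_on_id cont_x continuous_on_const that)
  moreover have "norm (F r y - F r z) \<le> L * norm (y - z)" if "r \<in> {t $ j..tf}" for r y z
    unfolding F_diff using that by (rule F_le)
  ultimately obtain v where v: "continuous_on {t $ j..tf} v"
    "\<And>s. s \<in> {t $ j..tf} \<Longrightarrow> ((\<lambda>r. F r (v r)) has_integral (v s - jump x j (t $ j))) {t $ j..s}"
    using picard_lindeloef_global[OF less_imp_le[OF tj(2)] L(1), of F "jump x j (t $ j)"] by blast
  have "((\<lambda>r. F r (v r)) has_integral (v (t $ j) - jump x j (t $ j))) {t $ j..t $ j}"
    using v(2)[of "t $ j"] tj by simp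
  moreover have "((\<lambda>r. F r (v r)) has_integral 0) {t $ j..t $ j}"
    by (simp add: has_integral_refl)
  ultimately have "v (t $ j) - jump x j (t $ j) = 0" by (rule has_integral_unique)
  then have v0: "v (t $ j) = jump x j (t $ j)" by simp
  have "bounded (v ` {t $ j..tf})"
    by (intro compact_imp_bounded compact_continuous_image v) simp
  then obtain B where B: "\<And>r. r \<in> {t $ j..tf} \<Longrightarrow> norm (v r) \<le> B"
    unfolding bounded_iff by blast
  have "ode_solution F (t $ j) tf v"
  proof (rule ode_solutionI)
    show "finite (range (($) t))" by simp
    show "norm (F r (v r)) \<le> L * B" if "r \<in> {t $ j..tf}" for r
      using F_le[OF that] B[OF that] L(1) by (meson mult_left_mono order_trans)
    show "((\<lambda>r. F r (v r)) has_integral (v s - v (t $ j))) {t $ j..s}" if "s \<in> {t $ j..tf}" for s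
      unfolding v0 using that by (rule v(2))
    show "continuous (at r within {t $ j..tf}) (\<lambda>r. F r (v r))"
      if "r \<in> {t $ j..tf} - range (($) t)" for r
      unfolding F_def control_def
      by (rule continuous_switched[where G = "\<lambda>J r. f' r (x r) (W J) (v r)",
            OF continuous_on_f'[OF continuous_on_id cont_x continuous_on_const v(1)] that])
  qed
  with v0 show ?thesis unfolding F_def by blast
qed

section \<open>From the expansion to differentiability\<close>

lemma jump_close:
  assumes "r \<in> {0..tf}" "x r \<in> cball 0 R" "y r \<in> cball 0 R"
    and "\<And>s w y. s \<in> {0..tf} \<Longrightarrow> w \<in> range W \<Longrightarrow> y \<in> cball 0 R \<Longrightarrow> onorm (f' s y w) \<le> L"
  shows "norm (jump y j r - jump x j r) \<le> 2 * L * norm (y r - x r)"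
proof -
  have *: "norm (f r (y r) (W J) - f r (x r) (W J)) \<le> L * norm (y r - x r)" for J
    by (rule f_lipschitz[OF convex_cball assms(4)[OF assms(1) rangeI] assms(3,2)])
  have "jump y j r - jump x j r = (f r (y r) (W {..<j}) - f r (x r) (W {..<j}))
      - (f r (y r) (W {..j}) - f r (x r) (W {..j}))"
    by (simp add: jump_def)
  also have "norm \<dots> \<le> L * norm (y r - x r) + L * norm (y r - x r)"
    by (intro order_trans[OF norm_triangle_ineq4] add_mono *)
  finally show ?thesis by simp
qed

lemma eventually_norm_less: "0 < d \<Longrightarrow> eventually (\<lambda>t'. norm (t' - t) < d) (nhds t)"
  by (auto simp: eventually_nhds_metric dist_norm)

text \<open>Finitely many strict inequalities between continuous functions define an open
  set.\<close>

lemma eventually_admissible: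
  assumes "strict_mono (($) t)" "\<And>j. 0 < t $ j \<and> t $ j < tf"
  shows "eventually (\<lambda>t'. strict_mono (($) t') \<and> (\<forall>j. 0 < t' $ j \<and> t' $ j < tf)) (nhds t)"
proof -
  have ev: "eventually P (nhds t)" if "open {t'. P t'}" "P t" for P
    using that unfolding eventually_nhds by blast
  have "eventually (\<lambda>t'. i < j \<longrightarrow> t' $ i < t' $ j) (nhds t)" for i j
    using strict_monoD[OF assms(1), of i j]
    by (cases "i < j") (auto intro!: ev open_Collect_less continuous_intros)
  then have "eventually (\<lambda>t'. \<forall>i j. i < j \<longrightarrow> t' $ i < t' $ j) (nhds t)"
    by (intro eventually_all_finite)
  moreover have "eventually (\<lambda>t'. \<forall>j. 0 < t' $ j \<and> t' $ j < tf) (nhds t)"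
    using assms(2)
    by (intro eventually_all_finite eventually_conj ev open_Collect_less continuous_intros) auto
  ultimately show ?thesis
    by eventually_elim (simp add: strict_mono_def)
qed

text \<open>\<open>E\<close> is prescribed only where a trajectory exists. By
  \<open>eventually_admissible\<close> and \<open>solution_stable\<close> this is so throughout a
  neighbourhood of \<open>t\<close>, hence the derivative in the full space makes sense.\<close>

lemma endpoint_has_derivative:
  assumes mono: "strict_mono (($) t)" and times: "\<And>j. 0 < t $ j \<and> t $ j < tf"
    and sol: "integral_solution f t x" and var: "\<And>j. variation t x j (v j)"
    and E: "\<And>t' y. strict_mono (($) t') \<Longrightarrow> (\<And>j. 0 < t' $ j \<and> t' $ j < tf) \<Longrightarrow>
      integral_solution f t' y \<Longrightarrow> E t' = y tf"
  shows "(E has_derivative (\<lambda>\<eta>. \<Sum>j\<in>UNIV. \<eta> $ j *\<^sub>R v j tf)) (at t)"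
  unfolding has_derivative_at_alt
proof (intro conjI allI impI)
  show "bounded_linear (\<lambda>\<eta>. \<Sum>j\<in>UNIV. \<eta> $ j *\<^sub>R v j tf)"
    by (intro bounded_linear_sum bounded_linear_scaleR_const bounded_linear_vec_nth)
  fix e :: real assume "0 < e"
  obtain R C \<delta>0 where "0 < \<delta>0" "0 \<le> C" and R: "\<And>r. r \<in> {0..tf} \<Longrightarrow> norm (x r) \<le> R"
    and stable: "\<And>t'. strict_mono (($) t') \<and> norm (t' - t) < \<delta>0 \<longrightarrow>
      (\<exists>y. integral_solution f t' y \<and>
        (\<forall>r\<in>{0..tf}. norm (y r) \<le> R \<and> norm (y r - x r) \<le> C * norm (t' - t)))"
    using solution_stable[OF mono sol] by blast
  obtain L where L: "0 \<le> L"
    "\<And>s w y. s \<in> {0..tf} \<Longrightarrow> w \<in> range W \<Longrightarrow> y \<in> cball 0 R \<Longrightarrow> onorm (f' s y w) \<le> L"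
    using f'_bounded[OF compact_range_W compact_cball] by blast
  define K where "K = (C * tf + L * (CARD('k) * tf + 2 * (\<Sum>j\<in>UNIV. norm (jump x j (t $ j))))) * exp (L * tf)
    + CARD('k)"
  have "0 \<le> K"
    unfolding K_def using \<open>0 \<le> C\<close> L(1) tf_pos
    by (intro add_nonneg_nonneg mult_nonneg_nonneg sum_nonneg) auto
  \<comment> \<open>Chosen so that the bound \<open>K * \<epsilon> * \<rho>\<close> of the expansion
    is at most \<open>e * \<rho>\<close>.\<close>
  define \<epsilon> where "\<epsilon> = e / (K + 1)"
  have "0 < \<epsilon>" using \<open>0 < e\<close> \<open>0 \<le> K\<close> by (simp add: \<epsilon>_def)
  obtain \<delta>1 where "0 < \<delta>1" and lin: "\<And>s w y z. s \<in> {0..tf} \<Longrightarrow> w \<in> range W \<Longrightarrow> y \<in> cball 0 R \<Longrightarrow>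
      z \<in> cball 0 R \<Longrightarrow> norm (z - y) < \<delta>1 \<Longrightarrow>
      norm (f s z w - f s y w - f' s y w (z - y)) \<le> \<epsilon> * norm (z - y)"
    using f_linearization[OF compact_range_W compact_cball convex_cball \<open>0 < \<epsilon>\<close>] by blast
  have "\<exists>d>0. \<forall>r\<in>{0..tf}. \<bar>r - t $ j\<bar> < d \<longrightarrow> norm (jump x j r - jump x j (t $ j)) < \<epsilon> / 2" for j
  proof -
    have "continuous_on {0..tf} (jump x j)"
      using sol by (intro continuous_on_jump) (simp add: integral_solution_def)
    moreover have "t $ j \<in> {0..tf}" using times[of j] by simp
    ultimately show ?thesis
      using half_gt_zero[OF \<open>0 < \<epsilon>\<close>] unfolding continuous_on_iff dist_norm real_norm_def by blast
  qed
  then obtain d where d: "\<And>j. 0 < d j" "\<And>j r. r \<in> {0..tf} \<Longrightarrow> \<bar>r - t $ j\<bar> < d j \<Longrightarrow>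
      norm (jump x j r - jump x j (t $ j)) < \<epsilon> / 2"
    by metis
  \<comment> \<open>In order: existence and boundedness of \<open>y\<close>; trading \<rho> for
    \<epsilon>; the linearization radius; a change of the jump by at most
    \<open>\<epsilon> / 2\<close> due to the state; the same due to time; windows closed before
    \<open>tf\<close>.\<close>
  have "eventually (\<lambda>t'. norm (t' - t) < \<delta>0) (nhds t)"
    "eventually (\<lambda>t'. norm (t' - t) < \<epsilon>) (nhds t)"
    "eventually (\<lambda>t'. norm (t' - t) < \<delta>1 / (C + 1)) (nhds t)"
    "eventually (\<lambda>t'. norm (t' - t) < \<epsilon> / (4 * L * C + 1)) (nhds t)"
    "eventually (\<lambda>t'. \<forall>j. norm (t' - t) < d j) (nhds t)"
    "eventually (\<lambda>t'. \<forall>j. norm (t' - t) < tf - t $ j) (nhds t)"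
    using \<open>0 < \<delta>0\<close> \<open>0 < \<epsilon>\<close> \<open>0 < \<delta>1\<close> \<open>0 \<le> C\<close> L(1) d(1) times
    by (auto intro!: eventually_norm_less eventually_all_finite divide_pos_pos add_nonneg_pos)
  with eventually_admissible[OF mono times]
  have "eventually (\<lambda>t'. norm (E t' - E t - (\<Sum>j\<in>UNIV. (t' - t) $ j *\<^sub>R v j tf)) \<le> e * norm (t' - t)) (nhds t)"
  proof eventually_elim
    case (elim t')
    define \<rho> where "\<rho> = norm (t' - t)"
    obtain y where y: "integral_solution f t' y"
      "\<And>r. r \<in> {0..tf} \<Longrightarrow> norm (y r) \<le> R \<and> norm (y r - x r) \<le> C * \<rho>"
      using stable[of t'] elim unfolding \<rho>_def by blast
    have "0 \<le> \<rho>" by (simp add: \<rho>_def)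
    have \<rho>1: "C * \<rho> < \<delta>1"
    proof -
      have "\<rho> * (C + 1) < \<delta>1" using elim(4) \<open>0 \<le> C\<close> by (simp add: \<rho>_def pos_less_divide_eq)
      then show ?thesis using \<open>0 \<le> \<rho>\<close> by (simp add: algebra_simps)
    qed
    have \<rho>2: "2 * L * (C * \<rho>) \<le> \<epsilon> / 2"
    proof -
      have "\<rho> * (4 * L * C + 1) < \<epsilon>"
        using elim(5) \<open>0 \<le> C\<close> L(1) by (simp add: \<rho>_def pos_less_divide_eq add_nonneg_pos)
      then show ?thesis using \<open>0 \<le> \<rho>\<close> by (simp add: algebra_simps)
    qed
    have "norm (y tf - x tf - (\<Sum>j\<in>UNIV. (t' $ j - t $ j) *\<^sub>R v j tf)) \<le> K * \<epsilon> * \<rho>"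
      unfolding K_def
    proof (rule endpoint_expansion[OF mono _ times _ sol y(1) var _ _ L \<rho>_def])
      show "strict_mono (($) t')" "\<And>j. 0 < t' $ j \<and> t' $ j < tf" using elim by auto
      show "x r \<in> cball 0 R" "y r \<in> cball 0 R" "norm (y r - x r) \<le> C * \<rho>" if "r \<in> {0..tf}" for r
        using R[OF that] y(2)[OF that] by auto
      show "\<rho> \<le> \<epsilon>" using elim by (simp add: \<rho>_def)
      show "t $ j + \<rho> \<le> tf" for j using elim by (simp add: \<rho>_def algebra_simps less_imp_le)
      show "0 \<le> C" by fact
      fix r assume r: "r \<in> {0..tf}"
      then have ball: "x r \<in> cball 0 R" "y r \<in> cball 0 R" using R y(2) by auto
      show "norm (f r (y r) w - f r (x r) w - f' r (x r) w (y r - x r)) \<le> \<epsilon> * norm (y r - x r)"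
        if "w \<in> range W" for w
        using y(2)[OF r] \<rho>1 by (intro lin r that ball) auto
      show "norm (jump y j r - jump x j (t $ j)) \<le> \<epsilon>" if "\<bar>r - t $ j\<bar> \<le> \<rho>" for j
      proof -
        have "norm (jump y j r - jump x j r) \<le> 2 * L * norm (y r - x r)"
          by (rule jump_close[where x = x and y = y, OF r ball]) (rule L(2))
        also have "\<dots> \<le> 2 * L * (C * \<rho>)"
          using y(2)[OF r] L(1) by (intro mult_left_mono) auto
        finally have "norm (jump y j r - jump x j r) \<le> \<epsilon> / 2" using \<rho>2 by linarith
        moreover have "\<bar>r - t $ j\<bar> < d j" using that elim(6) by (auto simp: \<rho>_def intro: le_less_trans)
        then have "norm (jump x j r - jump x j (t $ j)) < \<epsilon> / 2" by (rule d(2)[OF r])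
        ultimately show ?thesis
          using norm_triangle_ineq[of "jump y j r - jump x j r" "jump x j r - jump x j (t $ j)"] by simp
      qed
    qed
    moreover have "E t' = y tf" "E t = x tf"
      using elim y(1) by (auto intro!: E mono sol times)
    moreover have "K * \<epsilon> * \<rho> \<le> e * \<rho>"
      using \<open>0 < e\<close> \<open>0 \<le> K\<close> \<open>0 \<le> \<rho>\<close> by (intro mult_right_mono) (auto simp: \<epsilon>_def field_simps)
    ultimately show ?case by (simp add: \<rho>_def)
  qed
  then show "\<exists>d>0. \<forall>t'. norm (t' - t) < d \<longrightarrow>
      norm (E t' - E t - (\<Sum>j\<in>UNIV. (t' - t) $ j *\<^sub>R v j tf)) \<le> e * norm (t' - t)"
    unfolding eventually_nhds_metric dist_norm .
qed

end

section \<open>Bang-bang controls as values indexed by sets of switchings\<close>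

definition control_value :: "real ^ 'm \<Rightarrow> real ^ 'm \<Rightarrow> real ^ 'm \<Rightarrow> ('k::finite \<Rightarrow> 'm) \<Rightarrow> 'k set \<Rightarrow> real ^ ('m::finite)" where
  "control_value a b u0 idx J =
     (\<chi> i. (other_value (a $ i) (b $ i) ^^ card {j \<in> J. idx j = i}) (u0 $ i))"

lemma bang_bang_control_eq: "bang_bang_control a b u0 idx t s = control_value a b u0 idx {j. t $ j \<le> s}"
  unfolding bang_bang_control_def control_value_def
  by (simp add: conj_commute)

lemma control_value_in:
  assumes "\<And>i. u0 $ i \<in> {a $ i, b $ i}"
  shows "control_value a b u0 idx J $ i \<in> {a $ i, b $ i}"
proof -
  have "(other_value (a $ i) (b $ i) ^^ n) (u0 $ i) \<in> {a $ i, b $ i}" for n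
    using assms[of i] by (induction n) (auto simp: other_value_def)
  then show ?thesis by (simp add: control_value_def)
qed

text \<open>\<open>{..j}\<close> contains one more switching of the component \<open>idx j\<close>
  than \<open>{..<j}\<close>, and equally many of every other component.\<close>

lemma control_value_switch:
  fixes idx :: "'k::{finite,linorder} \<Rightarrow> 'm::finite"
  shows "control_value a b u0 idx {..j} $ i =
    (if i = idx j then other_value (a $ i) (b $ i) (control_value a b u0 idx {..<j} $ i)
     else control_value a b u0 idx {..<j} $ i)"
proof -
  have "{k \<in> {..j}. idx k = i} = (if i = idx j then insert j {k \<in> {..<j}. idx k = i} else {k \<in> {..<j}. idx k = i})"
    by (auto simp: order_le_less)
  then show ?thesis by (simp add: control_value_def)
qed

text \<open>As the values lie in \<open>{a $ i, b $ i}\<close> with \<open>a $ i < b $ i\<close>,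
  exactly one of the two premises holds, so the pair of implications determines \<open>z\<close>. In
  either case resetting the component \<open>idx j\<close> in the right limit gives back the left
  limit.\<close>

lemma variation_initial_value:
  fixes t :: "real ^ ('k::{finite,linorder})" and idx :: "'k \<Rightarrow> 'm::finite"
  assumes ab: "\<And>i. a $ i < b $ i" and u0: "\<And>i. u0 $ i \<in> {a $ i, b $ i}" and mono: "strict_mono (($) t)"
  defines "u \<equiv> bang_bang_control a b u0 idx t" and "W \<equiv> control_value a b u0 idx"
  shows "(let uR = Lim (at_right (t $ j)) u in
       (switches_at u (idx j) (t $ j) (a $ idx j) (b $ idx j) \<longrightarrow>
          z = f (t $ j) y (set_component uR (idx j) (a $ idx j)) - f (t $ j) y uR) \<and>
       (switches_at u (idx j) (t $ j) (b $ idx j) (a $ idx j) \<longrightarrow>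
          z = f (t $ j) y (set_component uR (idx j) (b $ idx j)) - f (t $ j) y uR))
    \<longleftrightarrow> z = f (t $ j) y (W {..<j}) - f (t $ j) y (W {..j})"
proof -
  let ?i = "idx j"
  have left: "Lim (at_left (t $ j)) u = W {..<j}"
    by (rule tendsto_Lim[OF trivial_limit_at_left_real], rule tendsto_eventually,
        rule eventually_mono[OF eventually_switches_left[OF mono, of j]])
       (simp add: u_def W_def bang_bang_control_eq)
  have right: "Lim (at_right (t $ j)) u = W {..j}"
    by (rule tendsto_Lim[OF trivial_limit_at_right_real], rule tendsto_eventually,
        rule eventually_mono[OF eventually_switches_right[OF mono, of j]])
       (simp add: u_def W_def bang_bang_control_eq)
  have in_ab: "W J $ i \<in> {a $ i, b $ i}" for J i
    unfolding W_def by (rule control_value_in[OF u0])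
  have toggle: "W {..j} $ i = (if i = ?i then other_value (a $ i) (b $ i) (W {..<j} $ i) else W {..<j} $ i)" for i
    unfolding W_def by (rule control_value_switch)
  have set_before: "set_component (W {..j}) ?i (W {..<j} $ ?i) = W {..<j}"
    by (auto simp: set_component_def vec_eq_iff toggle)
  have "a $ ?i \<noteq> b $ ?i" using ab[of ?i] by simp
  then show ?thesis
    using in_ab[of "{..<j}" ?i] set_before toggle[of ?i]
    by (auto simp: left right switches_at_def other_value_def)
qed

theorem proposition1:
  fixes f :: "real \<Rightarrow> real ^ 'n \<Rightarrow> real ^ 'm \<Rightarrow> real ^ 'n"
    and a b u0 :: "real ^ 'm"
    and x0 :: "real ^ 'n"
    and tf :: real
    and idx :: "('k::{finite,linorder}) \<Rightarrow> 'm"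
    and t :: "real ^ ('k::{finite,linorder})"
    and u :: "real \<Rightarrow> real ^ 'm"
    and x :: "real \<Rightarrow> real ^ 'n"
  assumes "smooth (\<lambda>(s, y, w). f s y w)"
    and "\<And>i. a $ i < b $ i"
    and "0 < tf"
    and "\<And>i. u0 $ i \<in> {a $ i, b $ i}"
    and "t \<in> endpoint_domain f a b x0 tf u0 idx"
    and "u = bang_bang_control a b u0 idx t"
    and "trajectory f x0 tf u x"
  shows "endpoint_map f a b x0 tf u0 idx differentiable (at t)
    \<and> (\<forall>j. \<exists>v. variation_solution f a b tf u x (t $ j) (idx j) v)
    \<and> (\<forall>v. (\<forall>j. variation_solution f a b tf u x (t $ j) (idx j) (v j)) \<longrightarrow>
          jacobian (endpoint_map f a b x0 tf u0 idx) (at t) = (\<chi> i j. v j tf $ i))"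
proof -
  define W where "W = control_value a b u0 idx"
  interpret switched_system f W tf x0
    by unfold_locales (use assms in auto)
  have u: "u = control t"
    by (simp add: assms(6) fun_eq_iff control_def bang_bang_control_eq W_def[symmetric])
  have trajectory_iff: "trajectory f x0 tf (bang_bang_control a b u0 idx t') y \<longleftrightarrow> integral_solution f t' y" for t' y
    unfolding trajectory_def solution_iff[symmetric]
    by (simp add: control_def bang_bang_control_eq W_def[symmetric])
  have mono: "strict_mono (($) t)" and times: "\<And>j. 0 < t $ j \<and> t $ j < tf"
    using assms(5) by (auto simp: endpoint_domain_def switching_times_def)
  have sol: "integral_solution f t x"
    using assms(6,7) trajectory_iff by simp
  have variation_iff: "variation_solution f a b tf u x (t $ j) (idx j) v \<longleftrightarrow>
      ode_solution (\<lambda>r w. f' r (x r) (control t r) w) (t $ j) tf v \<and> v (t $ j) = jump x j (t $ j)" for j v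
    unfolding variation_solution_def assms(6) variation_initial_value[OF assms(2,4) mono]
    by (simp add: frechet_derivative_f jump_def W_def[symmetric] u[unfolded assms(6)])
  have ex: "\<exists>v. variation_solution f a b tf u x (t $ j) (idx j) v" for j
    unfolding variation_iff using times sol
    by (intro variation_exists mono) (auto simp: integral_solution_def)
  \<comment> \<open>Uniqueness of trajectories makes the definite description denote
    \<open>y tf\<close>.\<close>
  have E: "endpoint_map f a b x0 tf u0 idx t' = y tf"
    if "strict_mono (($) t')" "integral_solution f t' y" for t' y
    unfolding endpoint_map_def trajectory_iff
    using that solution_unique[OF that(1)] tf_pos by (intro the_equality) auto
  have der: "(endpoint_map f a b x0 tf u0 idx has_derivative (\<lambda>\<eta>. \<Sum>j\<in>UNIV. \<eta> $ j *\<^sub>R v j tf)) (at t)"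
    if "\<And>j. variation_solution f a b tf u x (t $ j) (idx j) (v j)" for v
  proof (rule endpoint_has_derivative[OF mono times sol])
    show "variation t x j (v j)" for j
      using that[of j] unfolding variation_iff by (blast intro: ode_solution_variation)
  qed (rule E)
  \<comment> \<open>Differentiability is asserted without reference to given variations, so some are
    chosen first.\<close>
  obtain v0 where "\<And>j. variation_solution f a b tf u x (t $ j) (idx j) (v0 j)"
    using ex by metis
  then have "endpoint_map f a b x0 tf u0 idx differentiable (at t)"
    using der unfolding differentiable_def by blast
  moreover have "jacobian (endpoint_map f a b x0 tf u0 idx) (at t) = (\<chi> i j. v j tf $ i)"
    if "\<And>j. variation_solution f a b tf u x (t $ j) (idx j) (v j)" for v
  proof -
    \<comment> \<open>Column \<open>j\<close> of the Jacobian is the derivative in the direction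
      \<open>axis j 1\<close>.\<close>
    have "(\<Sum>k\<in>UNIV. axis j 1 $ k *\<^sub>R v k tf) = v j tf" for j
      by (simp add: axis_def if_distrib[of "\<lambda>c. c *\<^sub>R _"] cong: if_cong)
    then show ?thesis
      unfolding jacobian_def frechet_derivative_at[OF der[OF that], symmetric] matrix_def by simp
  qed
  ultimately show ?thesis using ex by blast
qed

end
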